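(* There exists a two-way entanglement purification protocol (2-EPP) which produces $2$ good EPR pairs from $6$ EPR pairs in the presence of up to $1$ error. This exceeds the quantum Hamming bound $2^k\sum_{j=0}^{t}3^j\binom{n}{j}\le 2^n$: this inequality fails for $n=6$, $k=2$, $t=1$.
   Context: An EPR pair is a two-qubit state $\frac{1}{\sqrt2}(|00\rangle+|11\rangle)$, with the first qubit held by Alice and the second by Bob. In an entanglement purification protocol on $n$ pairs, Alice prepares $n$ EPR pairs and sends the second half of each to Bob through a noisy quantum channel, which acts on the $n$ transmitted qubits. Alice and Bob then process their qubits by local quantum operations (including measurements) and communication over noiseless classical channels. The protocol is a two-way protocol (2-EPP) if classical communication is allowed in both directions, so that each local operation may depend on all measurement results communicated so far. At the end the parties output pairs of qubits (one qubit of each pair with Alice, one with Bob). A 2-EPP produces $k$ good EPR pairs from $n$ pairs with up to $t$ errors if, for every channel of the form $\mathcal{S}\otimes I$, where $\mathcal{S}$ is an arbitrary superoperator (quantum channel) acting on some set of at most $t$ of the $n$ transmitted qubits (the set being unknown to Alice and Bob) and $I$ is the identity on the remaining transmitted qubits, the protocol always (with probability 1) outputs at least $k$ pairs that are exactly (fidelity 1) in the state of perfect EPR pairs. The protocol may not depend on the set of affected qubits or on $\mathcal{S}$. *)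

theory Defs
  imports "Jordan_Normal_Form.Schur_Decomposition" Complex_Main
begin

section \<open>Operators and quantum operations\<close>

definition kron :: "complex mat \<Rightarrow> complex mat \<Rightarrow> complex mat" where
  "kron A B = mat (dim_row A * dim_row B) (dim_col A * dim_col B)
     (\<lambda>(i, j). A $$ (i div dim_row B, j div dim_col B) * B $$ (i mod dim_row B, j mod dim_col B))"

definition mat_trace :: "complex mat \<Rightarrow> complex" where
  "mat_trace A = (\<Sum>i<dim_row A. A $$ (i, i))"

definition projector :: "complex vec \<Rightarrow> complex mat" where
  "projector v = mat (dim_vec v) (dim_vec v) (\<lambda>(i, j). v $ i * conjugate (v $ j))"

definition mat_sum :: "nat \<Rightarrow> complex mat list \<Rightarrow> complex mat" where
  "mat_sum d As = foldr (+) As (0\<^sub>m d d)"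

text \<open>A completely positive map is given by a list of Kraus operators, here all of format
  \<open>d \<times> a\<close>: input dimension \<open>a\<close>, output dimension \<open>d\<close>.\<close>

definition apply_kraus :: "nat \<Rightarrow> complex mat list \<Rightarrow> complex mat \<Rightarrow> complex mat" where
  "apply_kraus d Ks \<rho> = mat_sum d (map (\<lambda>K. K * \<rho> * mat_adjoint K) Ks)"

definition kraus_complete :: "nat \<Rightarrow> complex mat list \<Rightarrow> bool" where
  "kraus_complete a Ks \<longleftrightarrow> mat_sum a (map (\<lambda>K. mat_adjoint K * K) Ks) = 1\<^sub>m a"

definition superoperator :: "nat \<Rightarrow> complex mat list \<Rightarrow> bool" where
  "superoperator d Ks \<longleftrightarrow> set Ks \<subseteq> carrier_mat d d \<and> kraus_complete d Ks"

section \<open>Qubits and EPR pairs\<close>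

text \<open>The basis state of a register of \<open>n\<close> qubits with index \<open>i < 2 ^ n\<close> has its qubit \<open>q\<close>
  in the state \<open>bit i q\<close>. A joint state of Alice and Bob, with local dimensions \<open>a\<close> and \<open>b\<close>,
  lives in dimension \<open>a * b\<close>, the basis state \<open>|x\<rangle>|y\<rangle>\<close> having index \<open>x * b + y\<close>, as in
  \<^const>\<open>kron\<close>.\<close>

definition epr_pair :: "complex vec" where
  "epr_pair = complex_of_real (1 / sqrt 2) \<cdot>\<^sub>v (unit_vec 4 0 + unit_vec 4 3)"

text \<open>The tensor product of \<open>n\<close> EPR pairs, with the factors regrouped so that the \<open>n\<close> qubits of
  Alice come first: pair \<open>q\<close> consists of qubit \<open>q\<close> of Alice and qubit \<open>q\<close> of Bob.\<close>

definition epr_pairs :: "nat \<Rightarrow> complex vec" where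
  "epr_pairs n = vec (2 ^ n * 2 ^ n)
     (\<lambda>i. \<Prod>q<n. epr_pair $ (2 * of_bool (bit (i div 2 ^ n) q) + of_bool (bit (i mod 2 ^ n) q)))"

text \<open>\<open>sub_index T i\<close> is the index of the qubits in \<open>T\<close>, in increasing order, as a register of
  their own.\<close>

definition sub_index :: "nat set \<Rightarrow> nat \<Rightarrow> nat" where
  "sub_index T i = horner_sum of_bool 2 (map (bit i) (sorted_list_of_set T))"

text \<open>\<open>act_on n T K\<close> is \<open>K \<otimes> I\<close>, where \<open>K\<close> acts on the qubits in \<open>T\<close> and \<open>I\<close> on the remaining
  ones of \<open>n\<close> qubits.\<close>

definition act_on :: "nat \<Rightarrow> nat set \<Rightarrow> complex mat \<Rightarrow> complex mat" where
  "act_on n T K = mat (2 ^ n) (2 ^ n)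
     (\<lambda>(i, j). if \<forall>q\<in>{..<n} - T. bit i q = bit j q
               then K $$ (sub_index T i, sub_index T j) else 0)"

text \<open>The joint state after Bob's halves of \<open>n\<close> EPR pairs have passed through the channel
  \<open>S \<otimes> I\<close>, where \<open>S\<close> acts on the transmitted qubits in \<open>T\<close> and has Kraus operators \<open>Ks\<close>.\<close>

definition noisy_epr_pairs :: "nat \<Rightarrow> nat set \<Rightarrow> complex mat list \<Rightarrow> complex mat" where
  "noisy_epr_pairs n T Ks =
     apply_kraus (2 ^ n * 2 ^ n) (map (\<lambda>K. kron (1\<^sub>m (2 ^ n)) (act_on n T K)) Ks)
       (projector (epr_pairs n))"

section \<open>Two-way entanglement purification protocols\<close>

datatype party = Alice | Bob

text \<open>In \<open>Local p bs\<close>, party \<open>p\<close> applies a quantum instrument with one entry of \<open>bs\<close> for each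
  outcome and announces the outcome. In an entry \<open>(d, Ks, P)\<close>, \<open>Ks\<close> are the Kraus operators of
  the operation belonging to that outcome, \<open>d\<close> is the dimension of the system that \<open>p\<close> holds
  afterwards, and \<open>P\<close> is the rest of the protocol; thus every later operation may depend on all
  outcomes announced so far. Local ancillas, discarding of subsystems, local randomness and
  measurement results that are not announced (kept in a local register) are all covered by several
  Kraus operators and varying dimensions. In \<open>Output m\<close>, each party holds exactly \<open>m\<close> qubits, and
  these are the output pairs.\<close>

datatype epp = Output nat | Local party "(nat \<times> complex mat list \<times> epp) list"

fun valid_epp :: "nat \<Rightarrow> nat \<Rightarrow> epp \<Rightarrow> bool" where
  "valid_epp a b (Output m) \<longleftrightarrow> a = 2 ^ m \<and> b = 2 ^ m"
| "valid_epp a b (Local Alice bs) \<longleftrightarrow>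
     kraus_complete a (concat (map (\<lambda>(d, Ks, P). Ks) bs)) \<and>
     (\<forall>(d, Ks, P)\<in>set bs. d > 0 \<and> set Ks \<subseteq> carrier_mat d a \<and> valid_epp d b P)"
| "valid_epp a b (Local Bob bs) \<longleftrightarrow>
     kraus_complete b (concat (map (\<lambda>(d, Ks, P). Ks) bs)) \<and>
     (\<forall>(d, Ks, P)\<in>set bs. d > 0 \<and> set Ks \<subseteq> carrier_mat d b \<and> valid_epp a d P)"

definition two_way_epp :: "nat \<Rightarrow> epp \<Rightarrow> bool" where
  "two_way_epp n P \<longleftrightarrow> valid_epp (2 ^ n) (2 ^ n) P"

text \<open>The set of all \<open>(m, \<sigma>)\<close> where \<open>m\<close> is the number of output pairs and \<open>\<sigma>\<close> the unnormalised
  output state in one run of the protocol, that is, for one sequence of outcomes; the probability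
  of that sequence is the trace of \<open>\<sigma>\<close>.\<close>

fun runs :: "nat \<Rightarrow> nat \<Rightarrow> epp \<Rightarrow> complex mat \<Rightarrow> (nat \<times> complex mat) set" where
  "runs a b (Output m) \<rho> = {(m, \<rho>)}"
| "runs a b (Local Alice bs) \<rho> =
     (\<Union>(d, Ks, P)\<in>set bs. runs d b P (apply_kraus (d * b) (map (\<lambda>K. kron K (1\<^sub>m b)) Ks) \<rho>))"
| "runs a b (Local Bob bs) \<rho> =
     (\<Union>(d, Ks, P)\<in>set bs. runs a d P (apply_kraus (a * d) (map (\<lambda>K. kron (1\<^sub>m a) K) Ks) \<rho>))"

definition produces_good_pairs :: "epp \<Rightarrow> nat \<Rightarrow> nat \<Rightarrow> nat \<Rightarrow> bool" where
  "produces_good_pairs P k n t \<longleftrightarrow>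
     (\<forall>T Ks. T \<subseteq> {..<n} \<longrightarrow> card T \<le> t \<longrightarrow> superoperator (2 ^ card T) Ks \<longrightarrow>
        (\<forall>(m, \<sigma>)\<in>runs (2 ^ n) (2 ^ n) P (noisy_epr_pairs n T Ks).
           mat_trace \<sigma> \<noteq> 0 \<longrightarrow>
           k \<le> m \<and> (1 / mat_trace \<sigma>) \<cdot>\<^sub>m \<sigma> = projector (epr_pairs m)))"

definition quantum_hamming_bound :: "nat \<Rightarrow> nat \<Rightarrow> nat \<Rightarrow> bool" where
  "quantum_hamming_bound n k t \<longleftrightarrow> 2 ^ k * (\<Sum>j=0..t. 3 ^ j * (n choose j)) \<le> (2 :: nat) ^ n"

end

theory Submission
  imports Defs
begin

text \<open>Alice and Bob first compare the parities of all six pairs in the computational basis. If they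
  differ, the error contains a bit flip; comparing the parity of the first three pairs tells which
  half is damaged, and the other half, on which only one parity has been measured, still contains two
  perfect pairs. If they agree, the error is the identity or a phase flip. Eliminating the sixth pair
  and applying Hadamard transforms to both sides turns this into a bit flip of a single one of five
  pairs, or of all five, or of none. Comparing the parity of the first four of these pairs separates
  the flips of one of these four from the other three possibilities, and after that two more bits
  identify the flip. Four pairs are enough because the second measurement
  depends on the result of the first one.

  A pure joint state is treated as the matrix of its amplitudes, so that local operators \<open>A\<close> and \<open>B\<close>
  turn \<open>M\<close> into \<open>A M B\<^sup>T\<close>, and perfect pairs are the multiples of the identity.\<close>


section \<open>Sums of matrices and pure states\<close>

lemma mat_sum_carrier:
  assumes "set As \<subseteq> carrier_mat d d"
  shows "mat_sum d As \<in> carrier_mat d d"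
  using assms by (induction As) (auto simp: mat_sum_def)

lemma mat_sum_index:
  assumes "set As \<subseteq> carrier_mat d d" "i < d" "j < d"
  shows "mat_sum d As $$ (i, j) = (\<Sum>A\<leftarrow>As. A $$ (i, j))"
  using assms
proof (induction As)
  case Nil
  then show ?case by (simp add: mat_sum_def)
next
  case (Cons A As)
  then have "mat_sum d As \<in> carrier_mat d d"
    by (intro mat_sum_carrier) auto
  with Cons show ?case by (auto simp: mat_sum_def)
qed

lemma mat_adjoint_carrier: "A \<in> carrier_mat n m \<Longrightarrow> mat_adjoint A \<in> carrier_mat m n"
  for A :: "complex mat"
  by (auto simp: mat_adjoint_def)

lemma mat_adjoint_index:
  fixes A :: "complex mat"
  assumes "A \<in> carrier_mat n m" "i < m" "j < n"
  shows "mat_adjoint A $$ (i, j) = cnj (A $$ (j, i))"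
  using assms by (auto simp: mat_adjoint_def mat_of_rows_index)

lemma projector_carrier: "projector v \<in> carrier_mat (dim_vec v) (dim_vec v)"
  by (simp add: projector_def)

text \<open>The double sum in an entry factors into an entry of \<open>K *\<^sub>v v\<close> and a
  conjugated one, so a Kraus operator can be followed on vectors.\<close>

lemma projector_conjugation:
  assumes K: "K \<in> carrier_mat d a" and v: "v \<in> carrier_vec a"
  shows "K * projector v * mat_adjoint K = projector (K *\<^sub>v v)"
proof (rule eq_matI)
  fix i j
  assume "i < dim_row (projector (K *\<^sub>v v))" "j < dim_col (projector (K *\<^sub>v v))"
  with K have ij: "i < d" "j < d" by (auto simp: projector_def)
  have adj: "mat_adjoint K \<in> carrier_mat a d"
    using K by (rule mat_adjoint_carrier)
  have "(K * projector v * mat_adjoint K) $$ (i, j) =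
      (\<Sum>k<a. (\<Sum>l<a. K $$ (i, l) * (v $ l * cnj (v $ k))) * cnj (K $$ (j, k)))"
    using ij K v adj projector_carrier[of v]
    by (auto simp: scalar_prod_def projector_def mat_adjoint_index[OF K] lessThan_atLeast0
        intro!: sum.cong)
  also have "\<dots> = (\<Sum>l<a. K $$ (i, l) * v $ l) * cnj (\<Sum>k<a. K $$ (j, k) * v $ k)"
    unfolding cnj_sum sum_product sum_distrib_right
    by (subst sum.swap) (simp add: sum_distrib_left mult_ac)
  also have "\<dots> = projector (K *\<^sub>v v) $$ (i, j)"
    using ij K v by (auto simp: scalar_prod_def projector_def lessThan_atLeast0)
  finally show "(K * projector v * mat_adjoint K) $$ (i, j) = projector (K *\<^sub>v v) $$ (i, j)" .
qed (use K in \<open>auto simp: projector_def mat_adjoint_def\<close>)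

text \<open>A single Kraus operator acts on a mixture vector by vector. Every operation of the
  protocol below has one Kraus operator per outcome, so the joint state remains a list of
  vectors.\<close>

lemma apply_kraus_singleton_mixture:
  assumes K: "K \<in> carrier_mat d a" and vs: "set vs \<subseteq> carrier_vec a"
  shows "apply_kraus d [K] (mat_sum a (map projector vs)) =
    mat_sum d (map (\<lambda>v. projector (K *\<^sub>v v)) vs)"
  using vs
proof (induction vs)
  case Nil
  have "K * 0\<^sub>m a a * mat_adjoint K = 0\<^sub>m d d"
    using K mat_adjoint_carrier[OF K] by auto
  then show ?case by (simp add: apply_kraus_def mat_sum_def)
next
  case (Cons v vs)
  let ?R = "mat_sum a (map projector vs)"
  have v: "v \<in> carrier_vec a" and vs: "set vs \<subseteq> carrier_vec a" using Cons.prems by auto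
  have R: "?R \<in> carrier_mat a a"
  proof (rule mat_sum_carrier, clarsimp)
    fix w assume "w \<in> set vs"
    with vs have "dim_vec w = a" by auto
    with projector_carrier[of w] show "projector w \<in> carrier_mat a a" by simp
  qed
  have pv: "projector v \<in> carrier_mat a a"
    using v projector_carrier[of v] by simp
  have adj: "mat_adjoint K \<in> carrier_mat a d" using K by (rule mat_adjoint_carrier)
  have "K * (projector v + ?R) * mat_adjoint K =
      K * projector v * mat_adjoint K + K * ?R * mat_adjoint K"
    using K R pv adj by (simp add: mult_add_distrib_mat[of _ d a] add_mult_distrib_mat[of _ d a])
  moreover have "K * ?R * mat_adjoint K + 0\<^sub>m d d = mat_sum d (map (\<lambda>v. projector (K *\<^sub>v v)) vs)"
    using Cons.IH[OF vs] by (simp add: apply_kraus_def mat_sum_def)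
  moreover have "K * ?R * mat_adjoint K + 0\<^sub>m d d = K * ?R * mat_adjoint K"
    using K R adj by (intro right_add_zero_mat) auto
  ultimately show ?case
    using projector_conjugation[OF K v] K R pv adj
    by (simp add: apply_kraus_def mat_sum_def)
qed

section \<open>Bipartite states as matrices\<close>

definition bip_vec :: "nat \<Rightarrow> nat \<Rightarrow> (nat \<Rightarrow> nat \<Rightarrow> complex) \<Rightarrow> complex vec" where
  "bip_vec a b f = vec (a * b) (\<lambda>i. f (i div b) (i mod b))"

text \<open>The vectors are unnormalised: the weights of the mixture sit in the amplitudes.\<close>

definition mixture :: "nat \<Rightarrow> nat \<Rightarrow> (nat \<Rightarrow> nat \<Rightarrow> complex) list \<Rightarrow> complex mat" where
  "mixture a b fs = mat_sum (a * b) (map projector (map (bip_vec a b) fs))"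

lemma bip_vec_carrier [simp]: "bip_vec a b f \<in> carrier_vec (a * b)"
  by (simp add: bip_vec_def)

lemma div_mod_less:
  fixes i :: nat
  assumes "i < a * b"
  shows "i div b < a" "i mod b < b"
proof -
  from assms have "b > 0" by (cases b) auto
  then show "i div b < a" "i mod b < b"
    using assms by (auto simp: less_mult_imp_div_less)
qed

lemma bip_vec_cong:
  assumes "\<And>x y. x < a \<Longrightarrow> y < b \<Longrightarrow> f x y = g x y"
  shows "bip_vec a b f = bip_vec a b g"
  unfolding bip_vec_def by (intro eq_vecI) (auto intro!: assms dest: div_mod_less)

lemma sum_div_mod:
  fixes h :: "nat \<Rightarrow> nat \<Rightarrow> complex"
  shows "(\<Sum>i<a * b. h (i div b) (i mod b)) = (\<Sum>x<a. \<Sum>y<b. h x y)"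
proof -
  have "(\<Sum>i<a * b. h (i div b) (i mod b)) = (\<Sum>(x, y)\<in>{..<a} \<times> {..<b}. h x y)"
  proof (rule sum.reindex_bij_witness[of _ "\<lambda>(x, y). x * b + y" "\<lambda>i. (i div b, i mod b)"])
    fix p assume "p \<in> {..<a} \<times> {..<b}"
    then obtain x y where p: "p = (x, y)" "x < a" "y < b" by auto
    have "x * b + y < (x + 1) * b" using p by simp
    also have "\<dots> \<le> a * b" using p by (intro mult_right_mono) auto
    finally show "(case p of (x, y) \<Rightarrow> x * b + y) \<in> {..<a * b}" using p by simp
    show "((case p of (x, y) \<Rightarrow> x * b + y) div b, (case p of (x, y) \<Rightarrow> x * b + y) mod b) = p"
      using p by auto
  qed (auto dest: div_mod_less)
  then show ?thesis by (simp add: sum.cartesian_product)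
qed

lemma kron_mult_bip_vec:
  assumes A: "A \<in> carrier_mat c a" and B: "B \<in> carrier_mat d b"
  shows "kron A B *\<^sub>v bip_vec a b f =
    bip_vec c d (\<lambda>x y. \<Sum>x'<a. \<Sum>y'<b. A $$ (x, x') * B $$ (y, y') * f x' y')"
proof (rule eq_vecI)
  fix i
  assume "i < dim_vec (bip_vec c d (\<lambda>x y. \<Sum>x'<a. \<Sum>y'<b. A $$ (x, x') * B $$ (y, y') * f x' y'))"
  then have i: "i < c * d" by (simp add: bip_vec_def)
  have "(kron A B *\<^sub>v bip_vec a b f) $ i =
      (\<Sum>j<a * b. A $$ (i div d, j div b) * B $$ (i mod d, j mod b) * f (j div b) (j mod b))"
    using A B i by (auto simp: kron_def bip_vec_def scalar_prod_def lessThan_atLeast0)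
  also have "\<dots> = (\<Sum>x'<a. \<Sum>y'<b. A $$ (i div d, x') * B $$ (i mod d, y') * f x' y')"
    by (rule sum_div_mod)
  finally show "(kron A B *\<^sub>v bip_vec a b f) $ i =
      bip_vec c d (\<lambda>x y. \<Sum>x'<a. \<Sum>y'<b. A $$ (x, x') * B $$ (y, y') * f x' y') $ i"
    using i by (simp add: bip_vec_def)
qed (use A B in \<open>auto simp: kron_def bip_vec_def\<close>)

lemma kron_one_mult_bip_vec:
  assumes A: "A \<in> carrier_mat d a"
  shows "kron A (1\<^sub>m b) *\<^sub>v bip_vec a b f = bip_vec d b (\<lambda>x y. \<Sum>x'<a. A $$ (x, x') * f x' y)"
proof -
  have "(\<Sum>x'<a. \<Sum>y'<b. A $$ (x, x') * 1\<^sub>m b $$ (y, y') * f x' y') =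
      (\<Sum>x'<a. A $$ (x, x') * f x' y)" if y: "y < b" for x y
  proof (rule sum.cong)
    fix x'
    have "(\<Sum>y'<b. A $$ (x, x') * 1\<^sub>m b $$ (y, y') * f x' y') =
        (\<Sum>y'<b. if y' = y then A $$ (x, x') * f x' y' else 0)"
      using y by (intro sum.cong) auto
    then show "(\<Sum>y'<b. A $$ (x, x') * 1\<^sub>m b $$ (y, y') * f x' y') = A $$ (x, x') * f x' y"
      using y by simp
  qed simp
  then show ?thesis
    unfolding kron_mult_bip_vec[OF A one_carrier_mat] by (intro bip_vec_cong)
qed

lemma one_kron_mult_bip_vec:
  assumes B: "B \<in> carrier_mat d b"
  shows "kron (1\<^sub>m a) B *\<^sub>v bip_vec a b f = bip_vec a d (\<lambda>x y. \<Sum>y'<b. B $$ (y, y') * f x y')"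
proof -
  have "(\<Sum>x'<a. \<Sum>y'<b. 1\<^sub>m a $$ (x, x') * B $$ (y, y') * f x' y') =
      (\<Sum>y'<b. B $$ (y, y') * f x y')" if x: "x < a" for x y
  proof -
    have "(\<Sum>x'<a. \<Sum>y'<b. 1\<^sub>m a $$ (x, x') * B $$ (y, y') * f x' y') =
        (\<Sum>x'<a. if x' = x then \<Sum>y'<b. B $$ (y, y') * f x' y' else 0)"
      using x by (intro sum.cong) auto
    then show ?thesis using x by simp
  qed
  then show ?thesis
    unfolding kron_mult_bip_vec[OF one_carrier_mat B] by (intro bip_vec_cong)
qed

lemma kron_carrier: "A \<in> carrier_mat c a \<Longrightarrow> B \<in> carrier_mat d b \<Longrightarrow> kron A B \<in> carrier_mat (c * d) (a * b)"
  by (auto simp: kron_def)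

lemma apply_kraus_mixture_Alice:
  assumes K: "K \<in> carrier_mat d a"
  shows "apply_kraus (d * b) (map (\<lambda>K. kron K (1\<^sub>m b)) [K]) (mixture a b fs) =
    mixture d b (map (\<lambda>f x y. \<Sum>x'<a. K $$ (x, x') * f x' y) fs)"
proof -
  have "set (map (bip_vec a b) fs) \<subseteq> carrier_vec (a * b)" by auto
  from apply_kraus_singleton_mixture[OF kron_carrier[OF K one_carrier_mat] this]
  show ?thesis by (simp add: mixture_def o_def kron_one_mult_bip_vec[OF K])
qed

lemma apply_kraus_mixture_Bob:
  assumes K: "K \<in> carrier_mat d b"
  shows "apply_kraus (a * d) (map (\<lambda>K. kron (1\<^sub>m a) K) [K]) (mixture a b fs) =
    mixture a d (map (\<lambda>f x y. \<Sum>y'<b. K $$ (y, y') * f x y') fs)"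
proof -
  have "set (map (bip_vec a b) fs) \<subseteq> carrier_vec (a * b)" by auto
  from apply_kraus_singleton_mixture[OF kron_carrier[OF one_carrier_mat K] this]
  show ?thesis by (simp add: mixture_def o_def one_kron_mult_bip_vec[OF K])
qed

section \<open>Amplitudes of perfect and of noisy EPR pairs\<close>

lemma nat_eq_iff_bits:
  fixes x y :: nat
  assumes "x < 2 ^ n" "y < 2 ^ n"
  shows "x = y \<longleftrightarrow> (\<forall>k<n. bit x k = bit y k)"
proof -
  have "x = take_bit n x" "y = take_bit n y"
    using assms by (simp_all add: take_bit_nat_eq_self)
  then show ?thesis by (metis bit_eq_iff bit_take_bit_iff)
qed

text \<open>One differing bit makes the product over the pairs vanish, so only the indicator of
  \<open>x = y\<close> remains.\<close>

lemma epr_pairs_eq_bip_vec: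
  "epr_pairs n = bip_vec (2 ^ n) (2 ^ n) (\<lambda>x y. of_bool (x = y) * complex_of_real (1 / sqrt 2) ^ n)"
proof (rule eq_vecI)
  fix i
  assume "i < dim_vec (bip_vec (2 ^ n) (2 ^ n)
    (\<lambda>x y. of_bool (x = y) * complex_of_real (1 / sqrt 2) ^ n))"
  then have i: "i < 2 ^ n * 2 ^ n" by (simp add: bip_vec_def)
  define x y where "x = i div 2 ^ n" and "y = i mod 2 ^ n"
  have xy: "x < 2 ^ n" "y < 2 ^ n" using div_mod_less[OF i] by (auto simp: x_def y_def)
  have epr: "epr_pair $ (2 * of_bool b + of_bool c) =
      of_bool (b = c) * complex_of_real (1 / sqrt 2)" for b c
    by (cases b; cases c) (auto simp: epr_pair_def)
  have "epr_pairs n $ i =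
      (\<Prod>q<n. of_bool (bit x q = bit y q) * complex_of_real (1 / sqrt 2))"
    using i by (simp add: epr_pairs_def x_def y_def epr)
  also have "\<dots> = of_bool (x = y) * complex_of_real (1 / sqrt 2) ^ n"
  proof (cases "x = y")
    case False
    then obtain q where "q < n" "bit x q \<noteq> bit y q" using nat_eq_iff_bits[OF xy] by auto
    then have "(\<Prod>q<n. of_bool (bit x q = bit y q) * complex_of_real (1 / sqrt 2)) = 0"
      by (intro prod_zero) auto
    with False show ?thesis by simp
  qed simp
  finally show "epr_pairs n $ i =
      bip_vec (2 ^ n) (2 ^ n) (\<lambda>x y. of_bool (x = y) * complex_of_real (1 / sqrt 2) ^ n) $ i"
    using i by (simp add: bip_vec_def x_def y_def)
qed (simp add: epr_pairs_def bip_vec_def)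

text \<open>Exactly \<open>2 ^ n\<close> diagonal entries are nonzero, each equal to
  \<open>(1 / 2) ^ n\<close>.\<close>

lemma trace_projector_epr_pairs: "mat_trace (projector (epr_pairs n)) = 1"
proof -
  have sq: "(1 / complex_of_real (sqrt 2)) ^ n * (1 / complex_of_real (sqrt 2)) ^ n = (1 / 2) ^ n"
    by (simp flip: power_mult_distrib of_real_mult)
  have "mat_trace (projector (epr_pairs n)) =
      (\<Sum>i<(2 :: nat) ^ n * 2 ^ n. of_bool (i div 2 ^ n = i mod 2 ^ n) * (1 / 2 :: complex) ^ n)"
    unfolding mat_trace_def epr_pairs_eq_bip_vec
  proof (rule sum.cong)
    fix i :: nat
    assume "i \<in> {..<2 ^ n * 2 ^ n}"
    then show "projector (bip_vec (2 ^ n) (2 ^ n)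
        (\<lambda>x y. of_bool (x = y) * complex_of_real (1 / sqrt 2) ^ n)) $$ (i, i) =
      of_bool (i div 2 ^ n = i mod 2 ^ n) * (1 / 2) ^ n"
      by (cases "i div 2 ^ n = i mod 2 ^ n") (simp_all add: projector_def bip_vec_def sq)
  qed (simp add: projector_def bip_vec_def)
  also have "\<dots> = (\<Sum>x<(2 :: nat) ^ n. \<Sum>y<(2 :: nat) ^ n. of_bool (x = y) * (1 / 2 :: complex) ^ n)"
    by (rule sum_div_mod)
  also have "\<dots> = 1"
    by (simp add: power_divide of_bool_def if_distrib[of "\<lambda>x. x / _"] cong: if_cong)
  finally show ?thesis .
qed

text \<open>Applying an operator to Bob's side of a multiple of the identity matrix gives a multiple
  of its transpose, so each Kraus operator contributes one pure state with swapped
  arguments.\<close>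

lemma noisy_epr_pairs_eq_mixture:
  "noisy_epr_pairs n T Ks = mixture (2 ^ n) (2 ^ n)
     (map (\<lambda>K x y. complex_of_real (1 / sqrt 2) ^ n * act_on n T K $$ (y, x)) Ks)"
proof -
  have "kron (1\<^sub>m (2 ^ n)) (act_on n T K) * projector (epr_pairs n) *
        mat_adjoint (kron (1\<^sub>m (2 ^ n)) (act_on n T K)) =
      projector (bip_vec (2 ^ n) (2 ^ n)
        (\<lambda>x y. complex_of_real (1 / sqrt 2) ^ n * act_on n T K $$ (y, x)))" for K
  proof -
    have act: "act_on n T K \<in> carrier_mat (2 ^ n) (2 ^ n)" by (simp add: act_on_def)
    have "kron (1\<^sub>m (2 ^ n)) (act_on n T K) *\<^sub>v epr_pairs n = bip_vec (2 ^ n) (2 ^ n)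
        (\<lambda>x y. complex_of_real (1 / sqrt 2) ^ n * act_on n T K $$ (y, x))"
      unfolding epr_pairs_eq_bip_vec one_kron_mult_bip_vec[OF act]
    proof (rule bip_vec_cong)
      fix x y :: nat assume "x < 2 ^ n" "y < 2 ^ n"
      have "(\<Sum>y'<2 ^ n. act_on n T K $$ (y, y') *
            (of_bool (x = y') * complex_of_real (1 / sqrt 2) ^ n)) =
          (\<Sum>y'<2 ^ n. if y' = x then complex_of_real (1 / sqrt 2) ^ n * act_on n T K $$ (y, y') else 0)"
        by (intro sum.cong) auto
      with \<open>x < 2 ^ n\<close> show "(\<Sum>y'<2 ^ n. act_on n T K $$ (y, y') *
            (of_bool (x = y') * complex_of_real (1 / sqrt 2) ^ n)) =
          complex_of_real (1 / sqrt 2) ^ n * act_on n T K $$ (y, x)" by simp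
    qed
    with projector_conjugation[OF kron_carrier[OF one_carrier_mat act],
        of "epr_pairs n" "2 ^ n"] show ?thesis
      by (simp add: epr_pairs_eq_bip_vec)
  qed
  then show ?thesis
    by (simp add: noisy_epr_pairs_def apply_kraus_def mixture_def o_def)
qed

section \<open>Joint protocol steps\<close>

text \<open>Alice announces \<open>r\<close>, then Bob, whose measurement may depend on \<open>r\<close>, announces \<open>r'\<close>.\<close>

definition joint_step ::
  "nat \<Rightarrow> nat \<Rightarrow> (nat \<Rightarrow> complex mat) \<Rightarrow> (nat \<Rightarrow> nat \<Rightarrow> complex mat) \<Rightarrow> (nat \<Rightarrow> nat \<Rightarrow> epp) \<Rightarrow> epp"
  where "joint_step d n A B P = Local Alice (map (\<lambda>r. (d, [A r],
    Local Bob (map (\<lambda>r'. (d, [B r r'], P r r')) [0..<n]))) [0..<n])"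

text \<open>\<open>Q\<close> describes the possible amplitudes \<open>f x y\<close> of the pure states of which the joint state is a
  mixture; \<open>x\<close> is the index of Alice, \<open>y\<close> that of Bob.\<close>

definition purifies :: "nat \<Rightarrow> nat \<Rightarrow> ((nat \<Rightarrow> nat \<Rightarrow> complex) \<Rightarrow> bool) \<Rightarrow> epp \<Rightarrow> bool" where
  "purifies k a Q P \<longleftrightarrow> valid_epp a a P \<and>
     (\<forall>fs. (\<forall>f\<in>set fs. Q f) \<longrightarrow> (\<forall>(m, \<sigma>)\<in>runs a a P (mixture a a fs).
        m = k \<and> (\<exists>c. \<sigma> = c \<cdot>\<^sub>m projector (epr_pairs k))))"

lemma purifies_mono: "purifies k a Q' P \<Longrightarrow> (\<And>f. Q f \<Longrightarrow> Q' f) \<Longrightarrow> purifies k a Q P"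
  unfolding purifies_def by blast

lemma valid_joint_step:
  assumes "d > 0"
    and "\<And>r. r < n \<Longrightarrow> A r \<in> carrier_mat d a"
    and "\<And>r r'. r < n \<Longrightarrow> r' < n \<Longrightarrow> B r r' \<in> carrier_mat d a"
    and "kraus_complete a (map A [0..<n])"
    and "\<And>r. r < n \<Longrightarrow> kraus_complete a (map (B r) [0..<n])"
    and "\<And>r r'. r < n \<Longrightarrow> r' < n \<Longrightarrow> valid_epp d d (P r r')"
  shows "valid_epp a a (joint_step d n A B P)"
  using assms by (auto simp: joint_step_def o_def)

text \<open>For fixed outcomes each vector of the mixture is mapped to one vector, so a property of
  all vectors passes to its image under both operators, which the continuation has to
  handle.\<close>

lemma purifies_joint_step:
  assumes d: "d > 0"
    and A: "\<And>r. r < n \<Longrightarrow> A r \<in> carrier_mat d a"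
    and B: "\<And>r r'. r < n \<Longrightarrow> r' < n \<Longrightarrow> B r r' \<in> carrier_mat d a"
    and AK: "kraus_complete a (map A [0..<n])"
    and BK: "\<And>r. r < n \<Longrightarrow> kraus_complete a (map (B r) [0..<n])"
    and P: "\<And>r r'. r < n \<Longrightarrow> r' < n \<Longrightarrow> purifies k d (\<lambda>g. \<exists>f. Q f \<and>
      g = (\<lambda>x y. \<Sum>y'<a. B r r' $$ (y, y') * (\<Sum>x'<a. A r $$ (x, x') * f x' y'))) (P r r')"
  shows "purifies k a Q (joint_step d n A B P)"
proof -
  have "m = k \<and> (\<exists>c. \<sigma> = c \<cdot>\<^sub>m projector (epr_pairs k))"
    if Q: "\<forall>f\<in>set fs. Q f" and run: "(m, \<sigma>) \<in> runs a a (joint_step d n A B P) (mixture a a fs)"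
    for fs m \<sigma>
  proof -
    from run obtain r r' where r: "r < n" "r' < n" and
      run': "(m, \<sigma>) \<in> runs d d (P r r') (apply_kraus (d * d) (map (\<lambda>K. kron (1\<^sub>m d) K) [B r r'])
         (apply_kraus (d * a) (map (\<lambda>K. kron K (1\<^sub>m a)) [A r]) (mixture a a fs)))"
      by (auto simp: joint_step_def)
    let ?gs = "map (\<lambda>f x y. \<Sum>y'<a. B r r' $$ (y, y') * (\<Sum>x'<a. A r $$ (x, x') * f x' y')) fs"
    have "(m, \<sigma>) \<in> runs d d (P r r') (mixture d d ?gs)"
      using run' unfolding apply_kraus_mixture_Alice[OF A[OF r(1)]] apply_kraus_mixture_Bob[OF B[OF r]]
      by (simp add: o_def)
    moreover have "\<forall>g\<in>set ?gs. \<exists>f. Q f \<and>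
        g = (\<lambda>x y. \<Sum>y'<a. B r r' $$ (y, y') * (\<Sum>x'<a. A r $$ (x, x') * f x' y'))"
      using Q by auto
    ultimately show ?thesis
      using P[OF r] unfolding purifies_def by blast
  qed
  moreover have "valid_epp a a (joint_step d n A B P)"
    using assms by (intro valid_joint_step) (auto simp: purifies_def)
  ultimately show ?thesis unfolding purifies_def by blast
qed

lemma projector_smult: "projector (c \<cdot>\<^sub>v v) = (c * cnj c) \<cdot>\<^sub>m projector v"
  by (rule eq_matI) (auto simp: projector_def)

text \<open>Such amplitudes form a multiple of the EPR vector, and a sum of projectors onto
  multiples of one vector is a multiple of its projector. The factor may be 0, for outcomes that do
  not occur.\<close>

lemma purifies_Output:
  "purifies k (2 ^ k) (\<lambda>f. \<exists>c. \<forall>x<2 ^ k. \<forall>y<2 ^ k. f x y = c * of_bool (x = y)) (Output k)"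
proof -
  have "\<exists>c. mixture (2 ^ k) (2 ^ k) fs = c \<cdot>\<^sub>m projector (epr_pairs k)"
    if "\<forall>f\<in>set fs. \<exists>c. \<forall>x<2 ^ k. \<forall>y<2 ^ k. f x y = c * of_bool (x = y)" for fs
    using that
  proof (induction fs)
    case Nil
    have "mixture (2 ^ k) (2 ^ k) [] = 0 \<cdot>\<^sub>m projector (epr_pairs k)"
      by (rule eq_matI) (auto simp: mixture_def mat_sum_def projector_def epr_pairs_def)
    then show ?case by blast
  next
    case (Cons f fs)
    then obtain c e where c: "\<forall>x<2 ^ k. \<forall>y<2 ^ k. f x y = c * of_bool (x = y)"
      and e: "mixture (2 ^ k) (2 ^ k) fs = e \<cdot>\<^sub>m projector (epr_pairs k)"
      by auto
    let ?w = "complex_of_real (1 / sqrt 2) ^ k"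
    have "?w \<noteq> 0" by simp
    moreover have "bip_vec (2 ^ k) (2 ^ k) f = bip_vec (2 ^ k) (2 ^ k) (\<lambda>x y. c * of_bool (x = y))"
      using c by (intro bip_vec_cong) auto
    ultimately have "bip_vec (2 ^ k) (2 ^ k) f = (c / ?w) \<cdot>\<^sub>v epr_pairs k"
      unfolding epr_pairs_eq_bip_vec
      by (intro eq_vecI) (auto simp: bip_vec_def)
    then have "mixture (2 ^ k) (2 ^ k) (f # fs) =
        (c / ?w * cnj (c / ?w) + e) \<cdot>\<^sub>m projector (epr_pairs k)"
      using e by (simp only: mixture_def mat_sum_def list.map foldr.simps o_def projector_smult)
        (simp add: add_smult_distrib_right_mat[OF projector_carrier])
    then show ?case by blast
  qed
  then show ?thesis by (auto simp: purifies_def)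
qed

section \<open>Measurements in the computational basis\<close>

text \<open>For injective \<open>\<phi>\<close> this is the projection onto the span of the basis
  states \<open>\<phi> i\<close>, followed by relabelling them as \<open>i\<close>, which drops the
  measured bits from the register.\<close>

definition selection :: "nat \<Rightarrow> nat \<Rightarrow> (nat \<Rightarrow> nat) \<Rightarrow> complex mat" where
  "selection d a \<phi> = mat d a (\<lambda>(i, j). of_bool (j = \<phi> i))"

lemma selection_carrier [simp]: "selection d a \<phi> \<in> carrier_mat d a"
  by (simp add: selection_def)

text \<open>The outcomes \<open>r\<close> split the basis into \<open>n\<close> blocks of size
  \<open>d\<close>, and \<open>l\<close> numbers the states of a block.\<close>

definition bases_partition :: "nat \<Rightarrow> nat \<Rightarrow> nat \<Rightarrow> (nat \<Rightarrow> nat \<Rightarrow> nat) \<Rightarrow> bool" where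
  "bases_partition n d a \<phi> \<longleftrightarrow> bij_betw (\<lambda>(r, l). \<phi> r l) ({..<n} \<times> {..<d}) {..<a}"

lemma bases_partition_less: "bases_partition n d a \<phi> \<Longrightarrow> r < n \<Longrightarrow> l < d \<Longrightarrow> \<phi> r l < a"
  by (force simp: bases_partition_def bij_betw_def)

lemma bases_partitionI:
  assumes "n * d = a" "\<And>r l. r < n \<Longrightarrow> l < d \<Longrightarrow> \<phi> r l < a"
    and "\<And>r l r' l'. r < n \<Longrightarrow> l < d \<Longrightarrow> r' < n \<Longrightarrow> l' < d \<Longrightarrow> \<phi> r l = \<phi> r' l' \<Longrightarrow> r = r' \<and> l = l'"
  shows "bases_partition n d a \<phi>"
proof -
  have "inj_on (\<lambda>(r, l). \<phi> r l) ({..<n} \<times> {..<d})"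
    using assms(3) by (force simp: inj_on_def)
  \<comment> \<open>An injective map into a finite set of the same size is onto.\<close>
  moreover from this have "(\<lambda>(r, l). \<phi> r l) ` ({..<n} \<times> {..<d}) = {..<a}"
    using assms(1,2) by (intro card_subset_eq) (auto simp: card_image)
  ultimately show ?thesis by (simp add: bases_partition_def bij_betw_def)
qed

lemma kraus_complete_iff:
  assumes "set Ks \<subseteq> carrier_mat d a"
  shows "kraus_complete a Ks \<longleftrightarrow> (\<forall>i<a. \<forall>j<a.
    (\<Sum>K\<leftarrow>Ks. \<Sum>l<d. cnj (K $$ (l, i)) * K $$ (l, j)) = of_bool (i = j))"
proof -
  let ?S = "mat_sum a (map (\<lambda>K. mat_adjoint K * K) Ks)"
  have carr: "set (map (\<lambda>K. mat_adjoint K * K) Ks) \<subseteq> carrier_mat a a"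
  proof clarsimp
    fix K assume "K \<in> set Ks"
    with assms have "K \<in> carrier_mat d a" by auto
    then show "mat_adjoint K * K \<in> carrier_mat a a"
      using mat_adjoint_carrier[of K d a] by auto
  qed
  have entry: "?S $$ (i, j) = (\<Sum>K\<leftarrow>Ks. \<Sum>l<d. cnj (K $$ (l, i)) * K $$ (l, j))"
    if "i < a" "j < a" for i j
  proof -
    have "(mat_adjoint K * K) $$ (i, j) = (\<Sum>l<d. cnj (K $$ (l, i)) * K $$ (l, j))"
      if "K \<in> set Ks" for K
    proof -
      from assms that have K: "K \<in> carrier_mat d a" by auto
      show ?thesis
        using K mat_adjoint_carrier[OF K] \<open>i < a\<close> \<open>j < a\<close>
        by (auto simp: scalar_prod_def mat_adjoint_index[OF K] lessThan_atLeast0 intro!: sum.cong)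
    qed
    then have "map ((\<lambda>A. A $$ (i, j)) \<circ> (\<lambda>K. mat_adjoint K * K)) Ks =
        map (\<lambda>K. \<Sum>l<d. cnj (K $$ (l, i)) * K $$ (l, j)) Ks"
      by simp
    then show ?thesis
      unfolding mat_sum_index[OF carr that] map_map by (rule arg_cong)
  qed
  have "?S = 1\<^sub>m a \<longleftrightarrow> (\<forall>i<a. \<forall>j<a. ?S $$ (i, j) = of_bool (i = j))"
  proof
    assume "\<forall>i<a. \<forall>j<a. ?S $$ (i, j) = of_bool (i = j)"
    then show "?S = 1\<^sub>m a"
      using mat_sum_carrier[OF carr] by (intro eq_matI) auto
  qed auto
  then show ?thesis
    unfolding kraus_complete_def by (simp add: entry cong: conj_cong imp_cong)
qed

lemma cnj_of_bool [simp]: "cnj (of_bool b) = of_bool b"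
  by (cases b) auto

text \<open>Every basis state lies in exactly one block, so the projections onto the blocks add up
  to the identity.\<close>

lemma kraus_complete_selection:
  assumes "bases_partition n d a \<phi>"
  shows "kraus_complete a (map (\<lambda>r. selection d a (\<phi> r)) [0..<n])"
proof -
  have bij: "bij_betw (\<lambda>(r, l). \<phi> r l) ({..<n} \<times> {..<d}) {..<a}"
    using assms by (simp add: bases_partition_def)
  have "(\<Sum>r<n. \<Sum>l<d. cnj (selection d a (\<phi> r) $$ (l, i)) * selection d a (\<phi> r) $$ (l, j)) =
      (of_bool (i = j) :: complex)" if ij: "i < a" "j < a" for i j
  proof -
    have "(\<Sum>r<n. \<Sum>l<d. cnj (selection d a (\<phi> r) $$ (l, i)) * selection d a (\<phi> r) $$ (l, j)) =
        (\<Sum>(r, l)\<in>{..<n} \<times> {..<d}. (\<lambda>z. of_bool (i = z) * of_bool (j = z)) (\<phi> r l) :: complex)"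
      using ij by (auto simp: sum.cartesian_product[symmetric] selection_def intro!: sum.cong)
    also have "\<dots> = (\<Sum>z<a. of_bool (i = z) * of_bool (j = z))"
      using sum.reindex_bij_betw[OF bij, of "\<lambda>z. of_bool (i = z) * of_bool (j = z) :: complex"]
      by (simp add: case_prod_unfold)
    also have "\<dots> = (\<Sum>z<a. if z = i then of_bool (i = j) else 0)"
      by (intro sum.cong) auto
    also have "\<dots> = of_bool (i = j)" using ij by simp
    finally show ?thesis .
  qed
  then show ?thesis
    by (subst kraus_complete_iff[of _ d])
       (auto simp: selection_def o_def interv_sum_list_conv_sum_set_nat lessThan_atLeast0)
qed

definition select_step ::
  "nat \<Rightarrow> nat \<Rightarrow> nat \<Rightarrow> (nat \<Rightarrow> nat \<Rightarrow> nat) \<Rightarrow> (nat \<Rightarrow> nat \<Rightarrow> nat \<Rightarrow> nat) \<Rightarrow> (nat \<Rightarrow> nat \<Rightarrow> epp) \<Rightarrow> epp"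
  where "select_step d n a \<phi> \<psi> =
    joint_step d n (\<lambda>r. selection d a (\<phi> r)) (\<lambda>r r'. selection d a (\<psi> r r'))"

text \<open>After selections the remaining indices \<open>x\<close> and \<open>y\<close> stand for the original ones \<open>F x\<close> and \<open>G y\<close>,
  where the amplitudes are given by a function in \<open>C\<close>.\<close>

definition pullback where
  "pullback d F G C g \<longleftrightarrow> (\<exists>f. C f \<and> (\<forall>x<d. \<forall>y<d. g x y = f (F x) (G y)))"
  for F G :: "nat \<Rightarrow> nat" and f :: "nat \<Rightarrow> nat \<Rightarrow> complex"

lemma selection_sum:
  assumes "x < d" "\<phi> x < a"
  shows "(\<Sum>j<a. selection d a \<phi> $$ (x, j) * h j) = h (\<phi> x)"
proof -
  have "(\<Sum>j<a. selection d a \<phi> $$ (x, j) * h j) = (\<Sum>j<a. if j = \<phi> x then h j else 0)"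
    using assms by (intro sum.cong) (auto simp: selection_def)
  with assms show ?thesis by simp
qed

text \<open>Selections only rename indices: successive measurements compose the index maps and leave
  the amplitude function in \<open>C\<close> unchanged.\<close>

lemma purifies_select_step:
  assumes "d > 0" and \<phi>: "bases_partition n d a \<phi>" and \<psi>: "\<And>r. r < n \<Longrightarrow> bases_partition n d a (\<psi> r)"
    and P: "\<And>r r'. r < n \<Longrightarrow> r' < n \<Longrightarrow>
      purifies k d (pullback d (\<lambda>x. F (\<phi> r x)) (\<lambda>y. G (\<psi> r r' y)) C) (P r r')"
  shows "purifies k a (pullback a F G C) (select_step d n a \<phi> \<psi> P)"
  unfolding select_step_def
proof (rule purifies_joint_step)
  fix r r' assume r: "r < n" "r' < n"
  show "purifies k d (\<lambda>g. \<exists>f. pullback a F G C f \<and>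
      g = (\<lambda>x y. \<Sum>y'<a. selection d a (\<psi> r r') $$ (y, y') *
             (\<Sum>x'<a. selection d a (\<phi> r) $$ (x, x') * f x' y'))) (P r r')"
    using P[OF r]
  proof (rule purifies_mono)
    fix g
    assume "\<exists>f. pullback a F G C f \<and>
      g = (\<lambda>x y. \<Sum>y'<a. selection d a (\<psi> r r') $$ (y, y') *
             (\<Sum>x'<a. selection d a (\<phi> r) $$ (x, x') * f x' y'))"
    then obtain f h where "C h" and f: "\<forall>x<a. \<forall>y<a. f x y = h (F x) (G y)"
      and g: "g = (\<lambda>x y. \<Sum>y'<a. selection d a (\<psi> r r') $$ (y, y') *
             (\<Sum>x'<a. selection d a (\<phi> r) $$ (x, x') * f x' y'))"
      by (auto simp: pullback_def)
    have "g x y = h (F (\<phi> r x)) (G (\<psi> r r' y))" if "x < d" "y < d" for x y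
      using that f r bases_partition_less[OF \<phi>] bases_partition_less[OF \<psi>]
      by (simp add: g selection_sum)
    with \<open>C h\<close> show "pullback d (\<lambda>x. F (\<phi> r x)) (\<lambda>y. G (\<psi> r r' y)) C g"
      by (auto simp: pullback_def)
  qed
qed (use assms in \<open>auto intro!: kraus_complete_selection\<close>)

section \<open>Bit strings\<close>

abbreviation encode :: "bool list \<Rightarrow> nat" where
  "encode \<equiv> horner_sum of_bool 2"

lemma encode_less: "length bs = n \<Longrightarrow> 2 ^ n = a \<Longrightarrow> encode bs < a"
  using horner_sum_of_bool_2_less[of bs] by (metis of_nat_less_iff)

lemma sum_prod_bits:
  fixes h :: "nat \<Rightarrow> bool \<Rightarrow> complex"
  shows "(\<Sum>z<(2 :: nat) ^ n. \<Prod>k<n. h k (bit z k)) = (\<Prod>k<n. h k False + h k True)"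
proof (induction n)
  case (Suc n)
  \<comment> \<open>Split by the top bit \<open>n\<close>; the upper half is the lower one shifted
    by \<open>2 ^ n\<close>.\<close>
  have split: "{..<2 ^ Suc n} = {..<2 ^ n} \<union> (\<lambda>z. z + 2 ^ n) ` {..<2 ^ n :: nat}"
  proof -
    have "z \<in> (\<lambda>z. z + 2 ^ n) ` {..<2 ^ n}" if "z < 2 * 2 ^ n" "\<not> z < 2 ^ n" for z :: nat
      using that by (intro image_eqI[of _ _ "z - 2 ^ n"]) auto
    then show ?thesis by auto
  qed
  have low: "bit (z + 2 ^ n) k = bit z k" if "k < n" for z k :: nat
  proof -
    have "take_bit n (z + 2 ^ n) = take_bit n z" by (simp add: take_bit_eq_mod)
    then show ?thesis using that by (metis bit_take_bit_iff)
  qed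
  have high: "bit (z + 2 ^ n) n" "\<not> bit z n" if "z < 2 ^ n" for z :: nat
    using that by (simp_all add: bit_iff_odd)
  have "(\<Sum>z<(2 :: nat) ^ Suc n. \<Prod>k<Suc n. h k (bit z k)) =
      (\<Sum>z<(2 :: nat) ^ n. \<Prod>k<Suc n. h k (bit z k)) +
      (\<Sum>z<(2 :: nat) ^ n. \<Prod>k<Suc n. h k (bit (z + 2 ^ n) k))"
    unfolding split by (subst sum.union_disjoint) (auto simp: sum.reindex)
  also have "\<dots> = (\<Sum>z<(2 :: nat) ^ n. (\<Prod>k<n. h k (bit z k)) * h n False) +
      (\<Sum>z<(2 :: nat) ^ n. (\<Prod>k<n. h k (bit z k)) * h n True)"
    by (simp add: low high)
  also have "\<dots> = (\<Prod>k<Suc n. h k False + h k True)"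
    by (simp add: Suc.IH distrib_left flip: sum_distrib_right)
  finally show ?case .
qed simp

section \<open>The measurements\<close>

definition odd_ones :: "bool list \<Rightarrow> bool" where
  "odd_ones bs = foldr (\<noteq>) bs False"

text \<open>The following functions describe measurements: for the outcome in the first argument (or the
  last two, where Bob corrects for the difference between his outcome and the one of Alice), they map
  the basis states of the reduced system to those of the measured system.\<close>

definition fill_parity :: "nat \<Rightarrow> nat \<Rightarrow> nat" where
  "fill_parity s x = encode [bit x 0, bit x 1, bit x 2, bit x 3, bit x 4,
     odd_ones [bit x 0, bit x 1, bit x 2, bit x 3, bit x 4, bit s 0]]"

definition fill_first_block :: "nat \<Rightarrow> nat \<Rightarrow> nat" where
  "fill_first_block p z =
     encode [bit z 0, bit z 1, odd_ones [bit z 0, bit z 1, bit p 0], bit z 2, bit z 3]"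

definition fill_fourth_bit :: "nat \<Rightarrow> nat \<Rightarrow> nat" where
  "fill_fourth_bit p z =
     encode [bit z 0, bit z 1, bit z 2, odd_ones [bit z 0, bit z 1, bit z 2, bit p 0], bit z 3]"

definition keep_low :: "nat \<Rightarrow> nat \<Rightarrow> nat" where
  "keep_low v l = encode [bit l 0, bit l 1, bit v 0, bit v 1]"

definition keep_high :: "nat \<Rightarrow> nat \<Rightarrow> nat" where
  "keep_high v l = encode [bit v 0, bit v 1, bit l 0, bit l 1]"

definition keep_mid :: "nat \<Rightarrow> nat \<Rightarrow> nat" where
  "keep_mid r l = encode [bit r 0, bit l 0, bit l 1, bit r 1]"

text \<open>Here the possible flips are \<open>0000\<close>, \<open>0001\<close> and \<open>1111\<close>, distinguished by the outer bits.\<close>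

definition keep_mid_corrected :: "nat \<Rightarrow> nat \<Rightarrow> nat \<Rightarrow> nat" where
  "keep_mid_corrected r r' l = (let d = (bit r 0 \<noteq> bit r' 0) in
     encode [bit r' 0, bit l 0 \<noteq> d, bit l 1 \<noteq> d, bit r' 1])"

text \<open>Here the possible flips are \<open>1000\<close>, \<open>0100\<close>, \<open>0010\<close> and \<open>0000\<close> (where it was the eliminated bit),
  distinguished by the sums of bits 0 and 2 and of bits 1 and 2. The first two flips leave the two bits
  that are kept unchanged.\<close>

definition syndrome_coset :: "nat \<Rightarrow> nat \<Rightarrow> nat" where
  "syndrome_coset r l = encode [bit r 0 \<noteq> bit l 0, bit r 1 \<noteq> bit l 0, bit l 0, bit l 1]"

definition syndrome_coset_corrected :: "nat \<Rightarrow> nat \<Rightarrow> nat \<Rightarrow> nat" where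
  "syndrome_coset_corrected r r' l = (let d = (bit r 0 \<noteq> bit r' 0 \<and> bit r 1 \<noteq> bit r' 1);
     l0 = (bit l 0 \<noteq> d) in
     encode [bit r' 0 \<noteq> l0, bit r' 1 \<noteq> l0, l0, bit l 1])"

section \<open>Bits of the index maps and completeness of the measurements\<close>

lemma all_less_numeral:
  fixes Q :: "nat \<Rightarrow> bool"
  shows "(\<forall>k<1. Q k) \<longleftrightarrow> Q 0"
    "(\<forall>k<2. Q k) \<longleftrightarrow> Q 0 \<and> Q 1"
    "(\<forall>k<4. Q k) \<longleftrightarrow> Q 0 \<and> Q 1 \<and> Q 2 \<and> Q 3"
    "(\<forall>k<5. Q k) \<longleftrightarrow> Q 0 \<and> Q 1 \<and> Q 2 \<and> Q 3 \<and> Q 4"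
    "(\<forall>k<6. Q k) \<longleftrightarrow> Q 0 \<and> Q 1 \<and> Q 2 \<and> Q 3 \<and> Q 4 \<and> Q 5"
    "(\<forall>k<7. Q k) \<longleftrightarrow> Q 0 \<and> Q 1 \<and> Q 2 \<and> Q 3 \<and> Q 4 \<and> Q 5 \<and> Q 6"
  by (simp_all add: numeral_eq_Suc All_less_Suc2)

lemma eq_iff_bits:
  fixes x y :: nat
  shows "x < 2 \<Longrightarrow> y < 2 \<Longrightarrow> x = y \<longleftrightarrow> bit x 0 = bit y 0"
    and "x < 4 \<Longrightarrow> y < 4 \<Longrightarrow> x = y \<longleftrightarrow> bit x 0 = bit y 0 \<and> bit x 1 = bit y 1"
  using nat_eq_iff_bits[of x 1 y] nat_eq_iff_bits[of x 2 y]
  unfolding all_less_numeral by simp_all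

lemma odd_ones_simps: "odd_ones [] = False" "odd_ones (b # bs) = (b \<noteq> odd_ones bs)"
  by (simp_all add: odd_ones_def)

lemma bit_fill_parity:
  "bit (fill_parity s x) 0 = bit x 0" "bit (fill_parity s x) 1 = bit x 1"
  "bit (fill_parity s x) 2 = bit x 2" "bit (fill_parity s x) 3 = bit x 3"
  "bit (fill_parity s x) 4 = bit x 4"
  "bit (fill_parity s x) 5 = odd_ones [bit x 0, bit x 1, bit x 2, bit x 3, bit x 4, bit s 0]"
  by (simp_all only: fill_parity_def bit_horner_sum_bit_iff) simp_all

lemma bit_fill_first_block:
  "bit (fill_first_block p z) 0 = bit z 0" "bit (fill_first_block p z) 1 = bit z 1"
  "bit (fill_first_block p z) 2 = odd_ones [bit z 0, bit z 1, bit p 0]"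
  "bit (fill_first_block p z) 3 = bit z 2" "bit (fill_first_block p z) 4 = bit z 3"
  by (simp_all only: fill_first_block_def bit_horner_sum_bit_iff) simp_all

text \<open>Once the first three bits have parity \<open>p\<close>, the last three have the sum of
  \<open>p\<close> and \<open>s\<close> as their parity. Hence bit 5 involves no bit of the first
  half, and the halves can be treated separately.\<close>

lemma bit_fill_parity_fill_first_block:
  "bit (fill_parity s (fill_first_block p z)) 0 = bit z 0"
  "bit (fill_parity s (fill_first_block p z)) 1 = bit z 1"
  "bit (fill_parity s (fill_first_block p z)) 2 = (bit z 0 \<noteq> (bit z 1 \<noteq> bit p 0))"
  "bit (fill_parity s (fill_first_block p z)) 3 = bit z 2"
  "bit (fill_parity s (fill_first_block p z)) 4 = bit z 3"
  "bit (fill_parity s (fill_first_block p z)) 5 = (bit p 0 \<noteq> (bit z 2 \<noteq> (bit z 3 \<noteq> bit s 0)))"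
  unfolding bit_fill_parity bit_fill_first_block odd_ones_def
  by (cases "bit z 0"; cases "bit z 1"; simp)+

lemma bit_fill_fourth_bit:
  "bit (fill_fourth_bit p z) 0 = bit z 0" "bit (fill_fourth_bit p z) 1 = bit z 1" "bit (fill_fourth_bit p z) 2 = bit z 2"
  "bit (fill_fourth_bit p z) 3 = (bit z 0 \<noteq> (bit z 1 \<noteq> (bit z 2 \<noteq> bit p 0)))"
  "bit (fill_fourth_bit p z) 4 = bit z 3"
  by (simp_all only: fill_fourth_bit_def bit_horner_sum_bit_iff) (simp_all add: odd_ones_def)

lemma bit_keep:
  "bit (keep_low v l) 0 = bit l 0" "bit (keep_low v l) 1 = bit l 1"
  "bit (keep_low v l) 2 = bit v 0" "bit (keep_low v l) 3 = bit v 1"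
  "bit (keep_high v l) 0 = bit v 0" "bit (keep_high v l) 1 = bit v 1"
  "bit (keep_high v l) 2 = bit l 0" "bit (keep_high v l) 3 = bit l 1"
  "bit (keep_mid v l) 0 = bit v 0" "bit (keep_mid v l) 1 = bit l 0"
  "bit (keep_mid v l) 2 = bit l 1" "bit (keep_mid v l) 3 = bit v 1"
  by (simp_all only: keep_low_def keep_high_def keep_mid_def bit_horner_sum_bit_iff) simp_all

lemma bit_keep_mid_corrected:
  "bit (keep_mid_corrected r r' l) 0 = bit r' 0"
  "bit (keep_mid_corrected r r' l) 1 = (bit l 0 \<noteq> (bit r 0 \<noteq> bit r' 0))"
  "bit (keep_mid_corrected r r' l) 2 = (bit l 1 \<noteq> (bit r 0 \<noteq> bit r' 0))"
  "bit (keep_mid_corrected r r' l) 3 = bit r' 1"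
  by (simp_all only: keep_mid_corrected_def Let_def bit_horner_sum_bit_iff) simp_all

lemma bit_syndrome_coset:
  "bit (syndrome_coset r l) 0 = (bit r 0 \<noteq> bit l 0)"
  "bit (syndrome_coset r l) 1 = (bit r 1 \<noteq> bit l 0)"
  "bit (syndrome_coset r l) 2 = bit l 0" "bit (syndrome_coset r l) 3 = bit l 1"
  by (simp_all only: syndrome_coset_def bit_horner_sum_bit_iff) simp_all

lemma bit_syndrome_coset_corrected:
  "bit (syndrome_coset_corrected r r' l) 0 =
     (bit r' 0 \<noteq> (bit l 0 \<noteq> (bit r 0 \<noteq> bit r' 0 \<and> bit r 1 \<noteq> bit r' 1)))"
  "bit (syndrome_coset_corrected r r' l) 1 =
     (bit r' 1 \<noteq> (bit l 0 \<noteq> (bit r 0 \<noteq> bit r' 0 \<and> bit r 1 \<noteq> bit r' 1)))"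
  "bit (syndrome_coset_corrected r r' l) 2 =
     (bit l 0 \<noteq> (bit r 0 \<noteq> bit r' 0 \<and> bit r 1 \<noteq> bit r' 1))"
  "bit (syndrome_coset_corrected r r' l) 3 = bit l 1"
  by (simp_all only: syndrome_coset_corrected_def Let_def bit_horner_sum_bit_iff) simp_all

text \<open>It suffices to recover the bits of \<open>r\<close> and \<open>l\<close> from those of
  \<open>\<phi> r l\<close>; counting does the rest. The premises range over all \<open>r\<close>
  and \<open>l\<close> since the maps in use read only the low bits.\<close>

lemma bases_partition_bitsI:
  assumes "n = 2 ^ i" "d = 2 ^ j" "a = 2 ^ (i + j)"
    and "\<And>r l. \<phi> r l < a"
    and inj: "\<And>r l r' l'. \<forall>k<i + j. bit (\<phi> r l) k = bit (\<phi> r' l') k \<Longrightarrow>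
      (\<forall>k<i. bit r k = bit r' k) \<and> (\<forall>k<j. bit l k = bit l' k)"
  shows "bases_partition n d a \<phi>"
proof (rule bases_partitionI)
  fix r l r' l'
  assume "r < n" "l < d" "r' < n" "l' < d" "\<phi> r l = \<phi> r' l'"
  then show "r = r' \<and> l = l'"
    using inj[of r l r' l'] assms(1,2) nat_eq_iff_bits[of r i r'] nat_eq_iff_bits[of l j l'] by simp
qed (use assms in \<open>auto simp: power_add\<close>)

lemma bases_partition_fill_parity: "bases_partition 2 32 64 fill_parity"
proof (rule bases_partition_bitsI[where i = 1 and j = 5], goal_cases)
  case (4 r l)
  show ?case by (simp add: fill_parity_def encode_less)
next
  case (5 r l r' l')
  then show ?case
    by (simp only: all_less_numeral bit_fill_parity odd_ones_simps
        one_plus_numeral numeral_plus_numeral add_num_simps) satx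
qed simp_all

lemma bases_partition_fill_first_block: "bases_partition 2 16 32 fill_first_block"
proof (rule bases_partition_bitsI[where i = 1 and j = 4], goal_cases)
  case (4 r l)
  show ?case by (simp add: fill_first_block_def encode_less)
next
  case (5 r l r' l')
  then show ?case
    by (simp only: all_less_numeral bit_fill_first_block odd_ones_simps
        one_plus_numeral numeral_plus_numeral add_num_simps) satx
qed simp_all

lemma bases_partition_fill_fourth_bit: "bases_partition 2 16 32 fill_fourth_bit"
proof (rule bases_partition_bitsI[where i = 1 and j = 4], goal_cases)
  case (4 r l)
  show ?case by (simp add: fill_fourth_bit_def encode_less)
next
  case (5 r l r' l')
  then show ?case
    by (simp only: all_less_numeral bit_fill_fourth_bit odd_ones_simps
        one_plus_numeral numeral_plus_numeral add_num_simps) satx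
qed simp_all

lemma bases_partition_keep_low: "bases_partition 4 4 16 keep_low"
proof (rule bases_partition_bitsI[where i = 2 and j = 2], goal_cases)
  case (4 r l)
  show ?case by (simp add: keep_low_def encode_less)
next
  case (5 r l r' l')
  then show ?case
    by (simp only: all_less_numeral bit_keep odd_ones_simps
        one_plus_numeral numeral_plus_numeral add_num_simps)
qed simp_all

lemma bases_partition_keep_high: "bases_partition 4 4 16 keep_high"
proof (rule bases_partition_bitsI[where i = 2 and j = 2], goal_cases)
  case (4 r l)
  show ?case by (simp add: keep_high_def encode_less)
next
  case (5 r l r' l')
  then show ?case
    by (simp only: all_less_numeral bit_keep odd_ones_simps
        one_plus_numeral numeral_plus_numeral add_num_simps)
qed simp_all

lemma bases_partition_keep_mid: "bases_partition 4 4 16 keep_mid"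
proof (rule bases_partition_bitsI[where i = 2 and j = 2], goal_cases)
  case (4 r l)
  show ?case by (simp add: keep_mid_def encode_less)
next
  case (5 r l r' l')
  then show ?case
    by (simp only: all_less_numeral bit_keep odd_ones_simps
        one_plus_numeral numeral_plus_numeral add_num_simps)
qed simp_all

lemma bases_partition_keep_mid_corrected: "bases_partition 4 4 16 (keep_mid_corrected q)"
proof (rule bases_partition_bitsI[where i = 2 and j = 2], goal_cases)
  case (4 r l)
  show ?case by (simp add: keep_mid_corrected_def Let_def encode_less)
next
  case (5 r l r' l')
  then show ?case
    by (simp only: all_less_numeral bit_keep_mid_corrected odd_ones_simps
        one_plus_numeral numeral_plus_numeral add_num_simps) satx
qed simp_all

lemma bases_partition_syndrome_coset: "bases_partition 4 4 16 syndrome_coset"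
proof (rule bases_partition_bitsI[where i = 2 and j = 2], goal_cases)
  case (4 r l)
  show ?case by (simp add: syndrome_coset_def encode_less)
next
  case (5 r l r' l')
  then show ?case
    by (simp only: all_less_numeral bit_syndrome_coset odd_ones_simps
        one_plus_numeral numeral_plus_numeral add_num_simps) satx
qed simp_all

lemma bases_partition_syndrome_coset_corrected: "bases_partition 4 4 16 (syndrome_coset_corrected q)"
proof (rule bases_partition_bitsI[where i = 2 and j = 2], goal_cases)
  case (4 r l)
  show ?case by (simp add: syndrome_coset_corrected_def Let_def encode_less)
next
  case (5 r l r' l')
  then show ?case
    by (simp only: all_less_numeral bit_syndrome_coset_corrected odd_ones_simps
        one_plus_numeral numeral_plus_numeral add_num_simps) satx
qed simp_all

section \<open>Correction of the errors\<close>

text \<open>\<open>\<kappa>\<close> is an arbitrary operator on qubit \<open>q\<close>, so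
  superpositions of bit and phase flips are included.\<close>

definition one_qubit_error :: "(nat \<Rightarrow> nat \<Rightarrow> complex) \<Rightarrow> bool" where
  "one_qubit_error f \<longleftrightarrow> (\<exists>q<6. \<exists>\<kappa>. f = (\<lambda>x y.
     if \<forall>k<6. k \<noteq> q \<longrightarrow> bit x k = bit y k then \<kappa> (bit x q) (bit y q) else 0))"

text \<open>\<open>q < 5\<close> stands for the flip of bit \<open>q\<close>, \<open>q = 5\<close> for the flip of all five bits (which comes from a
  phase flip of the eliminated sixth pair), and \<open>q = 6\<close> for no flip.\<close>

definition flip :: "nat \<Rightarrow> nat \<Rightarrow> nat \<Rightarrow> bool" where
  "flip q x y \<longleftrightarrow> (\<forall>k<5. (bit x k \<noteq> bit y k) = (k = q \<or> q = 5))"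

text \<open>A superposition of no flip and one other flip. Both terms are followed to the end, where
  the outcomes leave at most one flip possible.\<close>

definition flip_error :: "(nat \<Rightarrow> nat \<Rightarrow> complex) \<Rightarrow> bool" where
  "flip_error f \<longleftrightarrow>
     (\<exists>q<6. \<exists>\<alpha> \<beta>. f = (\<lambda>x y. \<alpha> * of_bool (flip 6 x y) + \<beta> * of_bool (flip q x y)))"

text \<open>The entry at (0, 0) serves as the factor, so one equation expresses both the zeros off
  the diagonal and constancy along it.\<close>

lemma purifies_Output_two:
  assumes "\<And>f x y. C f \<Longrightarrow> x < 4 \<Longrightarrow> y < 4 \<Longrightarrow> f (F x) (G y) = f (F 0) (G 0) * of_bool (x = y)"
  shows "purifies 2 4 (pullback 4 F G C) (Output 2)"
proof -
  have "purifies 2 4 (\<lambda>f. \<exists>c. \<forall>x<4. \<forall>y<4. f x y = c * of_bool (x = y)) (Output 2)"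
    using purifies_Output[of 2] by simp
  then show ?thesis
  proof (rule purifies_mono)
    fix g
    assume "pullback 4 F G C g"
    then obtain f where "C f" and g: "\<forall>x<4. \<forall>y<4. g x y = f (F x) (G y)"
      unfolding pullback_def by blast
    have "g x y = f (F 0) (G 0) * of_bool (x = y)" if "x < 4" "y < 4" for x y
      using g assms[OF \<open>C f\<close> that] that by simp
    then show "\<exists>c. \<forall>x<4. \<forall>y<4. g x y = c * of_bool (x = y)" by blast
  qed
qed

lemma all_but_one_less_six:
  fixes Q :: "nat \<Rightarrow> bool"
  shows "(\<forall>k<6. k \<noteq> 0 \<longrightarrow> Q k) \<longleftrightarrow> Q 1 \<and> Q 2 \<and> Q 3 \<and> Q 4 \<and> Q 5"
    "(\<forall>k<6. k \<noteq> 1 \<longrightarrow> Q k) \<longleftrightarrow> Q 0 \<and> Q 2 \<and> Q 3 \<and> Q 4 \<and> Q 5"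
    "(\<forall>k<6. k \<noteq> 2 \<longrightarrow> Q k) \<longleftrightarrow> Q 0 \<and> Q 1 \<and> Q 3 \<and> Q 4 \<and> Q 5"
    "(\<forall>k<6. k \<noteq> 3 \<longrightarrow> Q k) \<longleftrightarrow> Q 0 \<and> Q 1 \<and> Q 2 \<and> Q 4 \<and> Q 5"
    "(\<forall>k<6. k \<noteq> 4 \<longrightarrow> Q k) \<longleftrightarrow> Q 0 \<and> Q 1 \<and> Q 2 \<and> Q 3 \<and> Q 5"
    "(\<forall>k<6. k \<noteq> 5 \<longrightarrow> Q k) \<longleftrightarrow> Q 0 \<and> Q 1 \<and> Q 2 \<and> Q 3 \<and> Q 4"
  by (simp_all add: all_less_numeral)

lemma flip_iff:
  "flip 0 x y \<longleftrightarrow>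
     (bit x 0 \<noteq> bit y 0) \<and> \<not> (bit x 1 \<noteq> bit y 1) \<and> \<not> (bit x 2 \<noteq> bit y 2) \<and>
     \<not> (bit x 3 \<noteq> bit y 3) \<and> \<not> (bit x 4 \<noteq> bit y 4)"
  "flip 1 x y \<longleftrightarrow>
     \<not> (bit x 0 \<noteq> bit y 0) \<and> (bit x 1 \<noteq> bit y 1) \<and> \<not> (bit x 2 \<noteq> bit y 2) \<and>
     \<not> (bit x 3 \<noteq> bit y 3) \<and> \<not> (bit x 4 \<noteq> bit y 4)"
  "flip 2 x y \<longleftrightarrow>
     \<not> (bit x 0 \<noteq> bit y 0) \<and> \<not> (bit x 1 \<noteq> bit y 1) \<and> (bit x 2 \<noteq> bit y 2) \<and>
     \<not> (bit x 3 \<noteq> bit y 3) \<and> \<not> (bit x 4 \<noteq> bit y 4)"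
  "flip 3 x y \<longleftrightarrow>
     \<not> (bit x 0 \<noteq> bit y 0) \<and> \<not> (bit x 1 \<noteq> bit y 1) \<and> \<not> (bit x 2 \<noteq> bit y 2) \<and>
     (bit x 3 \<noteq> bit y 3) \<and> \<not> (bit x 4 \<noteq> bit y 4)"
  "flip 4 x y \<longleftrightarrow>
     \<not> (bit x 0 \<noteq> bit y 0) \<and> \<not> (bit x 1 \<noteq> bit y 1) \<and> \<not> (bit x 2 \<noteq> bit y 2) \<and>
     \<not> (bit x 3 \<noteq> bit y 3) \<and> (bit x 4 \<noteq> bit y 4)"
  "flip 5 x y \<longleftrightarrow>
     (bit x 0 \<noteq> bit y 0) \<and> (bit x 1 \<noteq> bit y 1) \<and> (bit x 2 \<noteq> bit y 2) \<and>
     (bit x 3 \<noteq> bit y 3) \<and> (bit x 4 \<noteq> bit y 4)"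
  "flip 6 x y \<longleftrightarrow>
     \<not> (bit x 0 \<noteq> bit y 0) \<and> \<not> (bit x 1 \<noteq> bit y 1) \<and> \<not> (bit x 2 \<noteq> bit y 2) \<and>
     \<not> (bit x 3 \<noteq> bit y 3) \<and> \<not> (bit x 4 \<noteq> bit y 4)"
  by (simp_all add: flip_def all_less_numeral)

text \<open>Equal or complementary outcomes cancel, so comparing filled-in parity bits reduces to
  comparing the remaining bits.\<close>

lemma xor_eq_xor_iff:
  "(a \<noteq> (b \<noteq> p)) = (c \<noteq> (d \<noteq> p)) \<longleftrightarrow> (a = c) = (b = d)"
  "(p \<noteq> (a \<noteq> (b \<noteq> s))) = (p \<noteq> (c \<noteq> (d \<noteq> (\<not> s)))) \<longleftrightarrow> (a = c) \<noteq> (b = d)"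
  "(a \<noteq> (b \<noteq> p)) = (c \<noteq> (d \<noteq> (\<not> p))) \<longleftrightarrow> (a = c) \<noteq> (b = d)"
  "(p \<noteq> (a \<noteq> (b \<noteq> s))) = ((\<not> p) \<noteq> (c \<noteq> (d \<noteq> (\<not> s)))) \<longleftrightarrow> (a = c) = (b = d)"
  by argo+

lemma xor_shifted_xor_iff:
  "(a \<noteq> (b \<noteq> (r \<noteq> r'))) \<longleftrightarrow> (a = b) \<noteq> (r = r')"
  "((r \<noteq> (a \<noteq> (b \<noteq> p))) \<noteq> (r' \<noteq> ((c \<noteq> (r \<noteq> r')) \<noteq> ((d \<noteq> (r \<noteq> r')) \<noteq> p)))) \<longleftrightarrow>
     ((a = c) = (b = d)) \<noteq> (r = r')"
  by argo+

text \<open>Bob complements his kept bits when bit 0 differs, which undoes a flip of all five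
  bits.\<close>

lemma bit_keep_mid_diff:
  fixes p r r' x y
  defines "F \<equiv> fill_fourth_bit p (keep_mid r x)" and "G \<equiv> fill_fourth_bit p (keep_mid_corrected r r' y)"
  shows "(bit F 0 \<noteq> bit G 0) \<longleftrightarrow> bit r 0 \<noteq> bit r' 0"
    "(bit F 1 \<noteq> bit G 1) \<longleftrightarrow> (bit x 0 = bit y 0) \<noteq> (bit r 0 = bit r' 0)"
    "(bit F 2 \<noteq> bit G 2) \<longleftrightarrow> (bit x 1 = bit y 1) \<noteq> (bit r 0 = bit r' 0)"
    "(bit F 3 \<noteq> bit G 3) \<longleftrightarrow>
       ((bit x 0 = bit y 0) = (bit x 1 = bit y 1)) \<noteq> (bit r 0 = bit r' 0)"
    "(bit F 4 \<noteq> bit G 4) \<longleftrightarrow> bit r 1 \<noteq> bit r' 1"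
  unfolding F_def G_def bit_fill_fourth_bit bit_keep bit_keep_mid_corrected
  by (rule refl xor_shifted_xor_iff)+

lemma xor_conditional_xor_iff:
  "(a \<noteq> (b \<noteq> D)) \<longleftrightarrow> (a = b) = D"
  "((r \<noteq> a) \<noteq> (r' \<noteq> (b \<noteq> D))) \<longleftrightarrow> ((a = b) = D) = (r = r')"
  "((r \<noteq> a) \<noteq> ((t \<noteq> a) \<noteq> (a \<noteq> p))) \<noteq>
     ((r' \<noteq> (b \<noteq> D)) \<noteq> ((t' \<noteq> (b \<noteq> D)) \<noteq> ((b \<noteq> D) \<noteq> (\<not> p)))) \<longleftrightarrow>
     ((a = b) = D) \<noteq> ((r = r') = (t = t'))"
  by argo+

text \<open>\<open>D\<close> is Bob's correction. Both announced sums differ exactly for the flip of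
  bit 2, the only one of the four candidates that hits a kept bit.\<close>

lemma bit_syndrome_coset_diff:
  fixes p r r' x y
  assumes p': "bit p' 0 = (\<not> bit p 0)"
  defines "F \<equiv> fill_fourth_bit p (syndrome_coset r x)"
    and "G \<equiv> fill_fourth_bit p' (syndrome_coset_corrected r r' y)"
    and "D \<equiv> bit r 0 \<noteq> bit r' 0 \<and> bit r 1 \<noteq> bit r' 1"
  shows "(bit F 0 \<noteq> bit G 0) \<longleftrightarrow> ((bit x 0 = bit y 0) = D) = (bit r 0 = bit r' 0)"
    "(bit F 1 \<noteq> bit G 1) \<longleftrightarrow> ((bit x 0 = bit y 0) = D) = (bit r 1 = bit r' 1)"
    "(bit F 2 \<noteq> bit G 2) \<longleftrightarrow> (bit x 0 = bit y 0) = D"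
    "(bit F 3 \<noteq> bit G 3) \<longleftrightarrow>
       ((bit x 0 = bit y 0) = D) \<noteq> ((bit r 0 = bit r' 0) = (bit r 1 = bit r' 1))"
    "(bit F 4 \<noteq> bit G 4) \<longleftrightarrow> bit x 1 \<noteq> bit y 1"
  unfolding F_def G_def bit_fill_fourth_bit bit_syndrome_coset bit_syndrome_coset_corrected p'
    D_def[symmetric]
  by (rule refl xor_conditional_xor_iff)+

text \<open>Agreement outside \<open>q\<close> must force \<open>x = y\<close> and select the same
  entry of \<open>\<kappa>\<close> as at (0, 0), and agreement at (0, 0) must spread along the
  diagonal. Then the result is a multiple of the identity, whatever \<open>\<kappa>\<close>
  is.\<close>

lemma one_qubit_error_leaf:
  assumes f: "one_qubit_error f"
    and eq: "\<And>x y q. x < 4 \<Longrightarrow> y < 4 \<Longrightarrow> q < 6 \<Longrightarrow>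
      \<forall>k<6. k \<noteq> q \<longrightarrow> bit (F x) k = bit (G y) k \<Longrightarrow>
      x = y \<and> (\<forall>k<6. k \<noteq> q \<longrightarrow> bit (F 0) k = bit (G 0) k) \<and>
      bit (F x) q = bit (F 0) q \<and> bit (G y) q = bit (G 0) q"
    and diag: "\<And>x q. x < 4 \<Longrightarrow> q < 6 \<Longrightarrow>
      \<forall>k<6. k \<noteq> q \<longrightarrow> bit (F 0) k = bit (G 0) k \<Longrightarrow> \<forall>k<6. k \<noteq> q \<longrightarrow> bit (F x) k = bit (G x) k"
    and "x < 4" "y < 4"
  shows "f (F x) (G y) = f (F 0) (G 0) * of_bool (x = y)"
proof -
  from f obtain q \<kappa> where q: "q < 6" and f: "f = (\<lambda>x y.
     if \<forall>k<6. k \<noteq> q \<longrightarrow> bit x k = bit y k then \<kappa> (bit x q) (bit y q) else 0)"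
    unfolding one_qubit_error_def by blast
  define agree :: "nat \<Rightarrow> nat \<Rightarrow> bool"
    where "agree X Y \<longleftrightarrow> (\<forall>k<6. k \<noteq> q \<longrightarrow> bit X k = bit Y k)" for X Y
  have f: "f X Y = (if agree X Y then \<kappa> (bit X q) (bit Y q) else 0)" for X Y
    by (simp only: f agree_def)
  have eq': "x = y \<and> agree (F 0) (G 0) \<and> bit (F x) q = bit (F 0) q \<and> bit (G y) q = bit (G 0) q"
    if "agree (F x) (G y)"
    using eq[OF \<open>x < 4\<close> \<open>y < 4\<close> q] that unfolding agree_def by blast
  have diag': "agree (F x) (G x)" if "agree (F 0) (G 0)"
    using diag[OF \<open>x < 4\<close> q] that unfolding agree_def by blast
  show ?thesis
  proof (cases "agree (F x) (G y)")
    case True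
    with eq' have "x = y" "agree (F 0) (G 0)" "bit (F x) q = bit (F 0) q" "bit (G y) q = bit (G 0) q"
      by blast+
    with True show ?thesis by (simp add: f)
  next
    case False
    with diag' have "\<not> (x = y \<and> agree (F 0) (G 0))" by blast
    with False show ?thesis by (auto simp: f)
  qed
qed

text \<open>The bound is 7 because the no-flip term, with index 6, must meet the same conditions as
  the flip \<open>q\<close>.\<close>

lemma flip_error_leaf:
  assumes f: "flip_error f"
    and eq: "\<And>x y q. x < 4 \<Longrightarrow> y < 4 \<Longrightarrow> q < 7 \<Longrightarrow> flip q (F x) (G y) \<Longrightarrow>
      x = y \<and> flip q (F 0) (G 0)"
    and diag: "\<And>x q. x < 4 \<Longrightarrow> q < 7 \<Longrightarrow> flip q (F 0) (G 0) \<Longrightarrow> flip q (F x) (G x)"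
    and xy: "x < 4" "y < 4"
  shows "f (F x) (G y) = f (F 0) (G 0) * of_bool (x = y)"
proof -
  from f obtain q \<alpha> \<beta> where q: "q < 6"
    and f: "f = (\<lambda>x y. \<alpha> * of_bool (flip 6 x y) + \<beta> * of_bool (flip q x y))"
    unfolding flip_error_def by blast
  have "flip q (F x) (G y) \<longleftrightarrow> x = y \<and> flip q (F 0) (G 0)" if "q < 7" for q
    using eq[OF xy that] diag[OF xy(1) that] by blast
  with q show ?thesis by (simp add: f)
qed

section \<open>The four final measurements\<close>

lemma less_six_cases: "q < 6 \<Longrightarrow> q = 0 \<or> q = 1 \<or> q = 2 \<or> q = 3 \<or> q = 4 \<or> q = 5" for q :: nat
  using all_less_numeral(5)[of "\<lambda>k. q \<noteq> k"] by blast

lemma less_seven_cases: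
  "q < 7 \<Longrightarrow> q = 0 \<or> q = 1 \<or> q = 2 \<or> q = 3 \<or> q = 4 \<or> q = 5 \<or> q = 6" for q :: nat
  using all_less_numeral(6)[of "\<lambda>k. q \<noteq> k"] by blast

text \<open>Different total parities mean a bit flip; equal parities of the first three bits place
  it among bits 3 to 5. Those bits are fixed by the outcomes, so the entry of
  \<open>\<kappa>\<close> is a constant, and bits 0 and 1 are undamaged.\<close>

lemma odd_keep_low:
  assumes s: "bit s' 0 = (\<not> bit s 0)" and "one_qubit_error f" and xy: "x < 4" "y < 4"
  shows "f (fill_parity s (fill_first_block p (keep_low r x))) (fill_parity s' (fill_first_block p (keep_low r' y))) =
    f (fill_parity s (fill_first_block p (keep_low r 0))) (fill_parity s' (fill_first_block p (keep_low r' 0))) * of_bool (x = y)"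
  using \<open>one_qubit_error f\<close>
proof (rule one_qubit_error_leaf[where F = "\<lambda>x. fill_parity s (fill_first_block p (keep_low r x))"
      and G = "\<lambda>y. fill_parity s' (fill_first_block p (keep_low r' y))", OF _ _ _ xy], goal_cases)
  case (1 x y q)
  \<comment> \<open>For each \<open>q\<close> a propositional claim about bits; for
    \<open>q < 3\<close> the agreement contradicts the announced parities.\<close>
  from less_six_cases[OF 1(3)] 1(1,2,4) show ?case
    by - (elim disjE; simp only: all_but_one_less_six bit_fill_parity_fill_first_block bit_keep s eq_iff_bits(2)[OF 1(1,2)];
        simp only: xor_eq_xor_iff; elim conjE; simp)
next
  case (2 x q)
  from less_six_cases[OF 2(2)] 2(1,3) show ?case
    by - (elim disjE; simp only: all_but_one_less_six bit_fill_parity_fill_first_block bit_keep s;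
        simp only: xor_eq_xor_iff; elim conjE; simp)
qed

lemma odd_keep_high:
  assumes s: "bit s' 0 = (\<not> bit s 0)" and p: "bit p' 0 = (\<not> bit p 0)"
    and "one_qubit_error f" and xy: "x < 4" "y < 4"
  shows "f (fill_parity s (fill_first_block p (keep_high r x))) (fill_parity s' (fill_first_block p' (keep_high r' y))) =
    f (fill_parity s (fill_first_block p (keep_high r 0))) (fill_parity s' (fill_first_block p' (keep_high r' 0))) * of_bool (x = y)"
  using \<open>one_qubit_error f\<close>
proof (rule one_qubit_error_leaf[where F = "\<lambda>x. fill_parity s (fill_first_block p (keep_high r x))"
      and G = "\<lambda>y. fill_parity s' (fill_first_block p' (keep_high r' y))", OF _ _ _ xy], goal_cases)
  case (1 x y q)
  from less_six_cases[OF 1(3)] 1(1,2,4) show ?case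
    by - (elim disjE; simp only: all_but_one_less_six bit_fill_parity_fill_first_block bit_keep s p eq_iff_bits(2)[OF 1(1,2)];
        simp only: xor_eq_xor_iff; elim conjE; simp)
next
  case (2 x q)
  from less_six_cases[OF 2(2)] 2(1,3) show ?case
    by - (elim disjE; simp only: all_but_one_less_six bit_fill_parity_fill_first_block bit_keep s p;
        simp only: xor_eq_xor_iff; elim conjE; simp)
qed

text \<open>Equal parities of the first four bits leave no flip, the flip of bit 4 and the flip of
  all five; the measured bits 0 and 4 tell them apart.\<close>

lemma even_keep_mid:
  assumes "flip_error f" and xy: "x < 4" "y < 4"
  shows "f (fill_fourth_bit p (keep_mid r x)) (fill_fourth_bit p (keep_mid_corrected r r' y)) =
    f (fill_fourth_bit p (keep_mid r 0)) (fill_fourth_bit p (keep_mid_corrected r r' 0)) * of_bool (x = y)"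
  using \<open>flip_error f\<close>
proof (rule flip_error_leaf[where F = "\<lambda>x. fill_fourth_bit p (keep_mid r x)"
      and G = "\<lambda>y. fill_fourth_bit p (keep_mid_corrected r r' y)", OF _ _ _ xy], goal_cases)
  case (1 x y q)
  from less_seven_cases[OF 1(3)] 1(1,2,4) show ?case
    by - (elim disjE; simp only: flip_iff bit_keep_mid_diff eq_iff_bits(2)[OF 1(1,2)];
        elim conjE; simp)
next
  case (2 x q)
  from less_seven_cases[OF 2(2)] 2(1,3) show ?case
    by - (elim disjE; simp only: flip_iff bit_keep_mid_diff;
        elim conjE; simp)
qed

text \<open>Different parities of the first four bits leave exactly the flips of bits 0 to 3, and
  each has its own pair of announced differences.\<close>

lemma even_syndrome_coset:
  assumes p: "bit p' 0 = (\<not> bit p 0)" and "flip_error f" and xy: "x < 4" "y < 4"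
  shows "f (fill_fourth_bit p (syndrome_coset r x)) (fill_fourth_bit p' (syndrome_coset_corrected r r' y)) =
    f (fill_fourth_bit p (syndrome_coset r 0)) (fill_fourth_bit p' (syndrome_coset_corrected r r' 0)) * of_bool (x = y)"
  using \<open>flip_error f\<close>
proof (rule flip_error_leaf[where F = "\<lambda>x. fill_fourth_bit p (syndrome_coset r x)"
      and G = "\<lambda>y. fill_fourth_bit p' (syndrome_coset_corrected r r' y)", OF _ _ _ xy], goal_cases)
  case (1 x y q)
  from less_seven_cases[OF 1(3)] 1(1,2,4) show ?case
    by - (elim disjE; simp only: flip_iff bit_syndrome_coset_diff[OF p] eq_iff_bits(2)[OF 1(1,2)];
        elim conjE; cases "bit r 0 = bit r' 0"; cases "bit r 1 = bit r' 1"; simp)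
next
  case (2 x q)
  from less_seven_cases[OF 2(2)] 2(1,3) show ?case
    by - (elim disjE; simp only: flip_iff bit_syndrome_coset_diff[OF p];
        elim conjE; cases "bit r 0 = bit r' 0"; cases "bit r 1 = bit r' 1"; simp)
qed

section \<open>The branches for different and for equal total parity\<close>

definition odd_branch :: epp where
  "odd_branch = select_step 16 2 32 fill_first_block (\<lambda>_. fill_first_block) (\<lambda>p p'.
     if p = p' then select_step 4 4 16 keep_low (\<lambda>_. keep_low) (\<lambda>_ _. Output 2)
     else select_step 4 4 16 keep_high (\<lambda>_. keep_high) (\<lambda>_ _. Output 2))"

lemma bit_less_two_neq:
  fixes r r' :: nat
  assumes "r < 2" "r' < 2" "r \<noteq> r'"
  shows "bit r' 0 = (\<not> bit r 0)"
  using assms eq_iff_bits(1)[of r r'] by simp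

lemma purifies_odd_branch:
  assumes "s < 2" "s' < 2" "s \<noteq> s'"
  shows "purifies 2 32 (pullback 32 (fill_parity s) (fill_parity s') one_qubit_error) odd_branch"
  unfolding odd_branch_def
proof (rule purifies_select_step)
  fix p p' :: nat
  assume p: "p < 2" "p' < 2"
  note s = bit_less_two_neq[OF assms]
  let ?Q = "pullback 16 (\<lambda>x. fill_parity s (fill_first_block p x))
    (\<lambda>y. fill_parity s' (fill_first_block p' y)) one_qubit_error"
  have "purifies 2 16 ?Q (select_step 4 4 16 keep_low (\<lambda>_. keep_low) (\<lambda>_ _. Output 2))" if "p = p'"
    unfolding that
    by (rule purifies_select_step[OF _ bases_partition_keep_low bases_partition_keep_low])
      (simp, rule purifies_Output_two, rule odd_keep_low[OF s])
  moreover have "purifies 2 16 ?Q (select_step 4 4 16 keep_high (\<lambda>_. keep_high) (\<lambda>_ _. Output 2))"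
    if "p \<noteq> p'"
    by (rule purifies_select_step[OF _ bases_partition_keep_high bases_partition_keep_high])
      (simp, rule purifies_Output_two, rule odd_keep_high[OF s bit_less_two_neq[OF p that]])
  ultimately show "purifies 2 16 ?Q
     (if p = p' then select_step 4 4 16 keep_low (\<lambda>_. keep_low) (\<lambda>_ _. Output 2)
      else select_step 4 4 16 keep_high (\<lambda>_. keep_high) (\<lambda>_ _. Output 2))"
    by simp
qed (simp_all add: bases_partition_fill_first_block)

text \<open>Here Alice's second measurement depends on whether Bob's parity equals hers, so messages
  in both directions are used.\<close>

definition even_branch :: epp where
  "even_branch = select_step 16 2 32 fill_fourth_bit (\<lambda>_. fill_fourth_bit) (\<lambda>p p'.
     if p = p' then select_step 4 4 16 keep_mid keep_mid_corrected (\<lambda>_ _. Output 2)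
     else select_step 4 4 16 syndrome_coset syndrome_coset_corrected (\<lambda>_ _. Output 2))"

lemma purifies_even_branch: "purifies 2 32 (pullback 32 (\<lambda>x. x) (\<lambda>x. x) flip_error) even_branch"
  unfolding even_branch_def
proof (rule purifies_select_step)
  fix p p' :: nat
  assume p: "p < 2" "p' < 2"
  let ?Q = "pullback 16 (fill_fourth_bit p) (fill_fourth_bit p') flip_error"
  have "purifies 2 16 ?Q (select_step 4 4 16 keep_mid keep_mid_corrected (\<lambda>_ _. Output 2))" if "p = p'"
    unfolding that
    by (rule purifies_select_step[OF _ bases_partition_keep_mid bases_partition_keep_mid_corrected])
      (simp, rule purifies_Output_two, rule even_keep_mid)
  moreover have "purifies 2 16 ?Q
      (select_step 4 4 16 syndrome_coset syndrome_coset_corrected (\<lambda>_ _. Output 2))"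
    if "p \<noteq> p'"
    by (rule purifies_select_step[OF _ bases_partition_syndrome_coset
          bases_partition_syndrome_coset_corrected])
      (simp, rule purifies_Output_two, rule even_syndrome_coset[OF bit_less_two_neq[OF p that]])
  ultimately show "purifies 2 16 ?Q
     (if p = p' then select_step 4 4 16 keep_mid keep_mid_corrected (\<lambda>_ _. Output 2)
      else select_step 4 4 16 syndrome_coset syndrome_coset_corrected (\<lambda>_ _. Output 2))"
    by simp
qed (simp_all add: bases_partition_fill_fourth_bit)

section \<open>Phase errors in the Hadamard basis\<close>

text \<open>The character of bit strings given by \<open>c\<close>: -1 to the power of the inner
  product of \<open>c\<close> and \<open>z\<close>. It is the diagonal of the product of phase flips
  on the qubits in \<open>c\<close>.\<close>

definition sign_character :: "nat \<Rightarrow> (nat \<Rightarrow> bool) \<Rightarrow> nat \<Rightarrow> complex" where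
  "sign_character n c z = (\<Prod>k<n. if c k \<and> bit z k then - 1 else 1)"

text \<open>Orthogonality of characters: each position in \<open>c\<close> contributes a factor
  \<open>1 + (-1)\<close>.\<close>

lemma sum_sign_character:
  "(\<Sum>z<2 ^ n. sign_character n c z) = 2 ^ n * of_bool (\<forall>k<n. \<not> c k)"
proof -
  have "(\<Sum>z<2 ^ n. sign_character n c z) =
      (\<Prod>k<n. (if c k \<and> False then - 1 else 1) + (if c k \<and> True then - 1 else 1))"
    unfolding sign_character_def by (rule sum_prod_bits)
  also have "\<dots> = (\<Prod>k<n. if c k then 0 else 2)"
    by (intro prod.cong) auto
  also have "\<dots> = 2 ^ n * of_bool (\<forall>k<n. \<not> c k)"
  proof (cases "\<forall>k<n. \<not> c k")
    case True
    then have "(\<Prod>k<n. if c k then 0 else 2) = (\<Prod>k<n. 2 :: complex)"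
      by (intro prod.cong) auto
    with True show ?thesis by simp
  next
    case False
    then have "(\<Prod>k<n. if c k then 0 else 2 :: complex) = 0"
      by (intro prod_zero) auto
    with False show ?thesis by simp
  qed
  finally show ?thesis .
qed

lemma sign_character_mult:
  "sign_character n c z * sign_character n d z = sign_character n (\<lambda>k. c k \<noteq> d k) z"
  unfolding sign_character_def prod.distrib[symmetric] by (intro prod.cong) auto

definition hadamard :: "complex mat" where
  "hadamard = mat 32 32 (\<lambda>(i, j). complex_of_real (1 / sqrt 32) * sign_character 5 (bit i) j)"

lemma hadamard_carrier: "hadamard \<in> carrier_mat 32 32"
  by (simp add: hadamard_def)

text \<open>Conjugation by the Hadamard matrix turns phase flips with pattern \<open>u\<close> into
  bit flips with the same pattern; the sum is an entry of the conjugated diagonal matrix.\<close>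

lemma hadamard_sum:
  assumes "x < 32" "y < 32"
  shows "(\<Sum>z<32. hadamard $$ (x, z) * hadamard $$ (y, z) * sign_character 5 u z) =
    of_bool (\<forall>k<5. (bit x k \<noteq> bit y k) = u k)"
proof -
  have w: "complex_of_real (1 / sqrt 32) * complex_of_real (1 / sqrt 32) = 1 / 32"
    unfolding of_real_mult[symmetric] by simp
  have "(\<Sum>z<32. hadamard $$ (x, z) * hadamard $$ (y, z) * sign_character 5 u z) =
      (\<Sum>z<2 ^ 5. 1 / 32 * sign_character 5 (\<lambda>k. (bit x k \<noteq> bit y k) \<noteq> u k) z)"
  proof (rule sum.cong)
    fix z :: nat
    assume "z \<in> {..<2 ^ 5}"
    then have "hadamard $$ (x, z) * hadamard $$ (y, z) * sign_character 5 u z =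
        (complex_of_real (1 / sqrt 32) * complex_of_real (1 / sqrt 32)) *
        (sign_character 5 (bit x) z * sign_character 5 (bit y) z * sign_character 5 u z)"
      using assms by (simp only: hadamard_def) simp
    then show "hadamard $$ (x, z) * hadamard $$ (y, z) * sign_character 5 u z =
        1 / 32 * sign_character 5 (\<lambda>k. (bit x k \<noteq> bit y k) \<noteq> u k) z"
      unfolding w sign_character_mult .
  qed simp
  also have "\<dots> = of_bool (\<forall>k<5. (bit x k \<noteq> bit y k) = u k)"
    unfolding sum_distrib_left[symmetric] sum_sign_character by simp
  finally show ?thesis .
qed

lemma kraus_complete_hadamard: "kraus_complete 32 [hadamard]"
proof -
  have sym: "cnj (hadamard $$ (l, i)) = hadamard $$ (i, l)" "hadamard $$ (l, i) = hadamard $$ (i, l)"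
    if "l < 32" "i < 32" for l i
    using that unfolding hadamard_def sign_character_def
    by (auto simp: conj_commute intro!: prod.cong)
  have "(\<Sum>l<32. cnj (hadamard $$ (l, i)) * hadamard $$ (l, j)) = of_bool (i = j)"
    if "i < 32" "j < 32" for i j
  proof -
    \<comment> \<open>Unitarity is the case of the trivial character in
      \<open>hadamard_sum\<close>.\<close>
    have "(\<Sum>l<32. cnj (hadamard $$ (l, i)) * hadamard $$ (l, j)) =
        (\<Sum>l<32. hadamard $$ (i, l) * hadamard $$ (j, l) * sign_character 5 (\<lambda>_. False) l)"
      using sym that by (intro sum.cong) (auto simp: sign_character_def)
    also have "\<dots> = of_bool (i = j)"
      using that nat_eq_iff_bits[of i 5 j] by (simp add: hadamard_sum)
    finally show ?thesis .
  qed
  then show ?thesis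
    by (subst kraus_complete_iff[of _ 32]) (use hadamard_carrier in auto)
qed

section \<open>Equal total parity: reduction to phase errors\<close>

lemma xor_cancel:
  fixes a b c :: bool
  shows
  "(c \<noteq> a) = (c \<noteq> b) \<longleftrightarrow> a = b" "(a \<noteq> c) = (b \<noteq> c) \<longleftrightarrow> a = b"
  by auto

text \<open>With equal parities, agreement in five bits forces agreement in the sixth, so no bit
  flip remains and the amplitudes are diagonal.\<close>

lemma same_parity_agree:
  assumes "q < 6" "x < 32" "y < 32"
    and "\<forall>k<6. k \<noteq> q \<longrightarrow> bit (fill_parity s x) k = bit (fill_parity s y) k"
  shows "x = y"
proof -
  have "\<forall>k<5. bit x k = bit y k"
    using less_six_cases[OF assms(1)] assms(4)
    by - (elim disjE; simp only: all_but_one_less_six all_less_numeral bit_fill_parity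
        odd_ones_simps; elim conjE; intro conjI; simp only: xor_cancel)
  then show ?thesis using nat_eq_iff_bits[of x 5 y] assms(2,3) by simp
qed

lemma odd_ones_snoc: "odd_ones (bs @ [b]) = (odd_ones bs \<noteq> b)"
  by (induction bs) (auto simp: odd_ones_simps)

lemma sign_character_all:
  "sign_character n (\<lambda>_. True) x = (if odd_ones (map (bit x) [0..<n]) then - 1 else 1)"
  by (induction n) (simp_all add: sign_character_def odd_ones_snoc odd_ones_simps)

lemma bit_fill_parity_last:
  "bit (fill_parity s x) 5 \<longleftrightarrow> odd_ones (map (bit x) [0..<5]) \<noteq> bit s 0"
  unfolding bit_fill_parity odd_ones_snoc[symmetric] by (simp add: numeral_eq_Suc)

text \<open>A diagonal operator on one qubit combines the identity and a phase flip. The sixth bit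
  is the parity of the others plus \<open>s\<close>, so its phase flip equals phase flips of all
  five others up to a sign given by \<open>s\<close>.\<close>

lemma one_qubit_error_same_parity:
  assumes "one_qubit_error f"
  shows "\<exists>q<6. \<exists>\<alpha> \<beta>. \<forall>x<32. \<forall>y<32. f (fill_parity s x) (fill_parity s y) =
    of_bool (x = y) * (\<alpha> + \<beta> * sign_character 5 (\<lambda>k. k = q \<or> q = 5) x)"
proof -
  from assms obtain q \<kappa> where q: "q < 6" and f: "f = (\<lambda>x y.
     if \<forall>k<6. k \<noteq> q \<longrightarrow> bit x k = bit y k then \<kappa> (bit x q) (bit y q) else 0)"
    unfolding one_qubit_error_def by blast
  \<comment> \<open>The coefficients of the identity and of the phase flip in the diagonal part of
    \<open>\<kappa>\<close>.\<close>
  define \<alpha> \<delta> where "\<alpha> = (\<kappa> False False + \<kappa> True True) / 2"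
    and "\<delta> = (\<kappa> False False - \<kappa> True True) / 2"
  have \<kappa>: "\<kappa> b b = \<alpha> + \<delta> * (if b then - 1 else 1)" for b
    by (cases b) (simp_all add: \<alpha>_def \<delta>_def field_simps)
  define \<beta> where "\<beta> = (if q = 5 \<and> bit s 0 then - \<delta> else \<delta>)"
  have diag: "\<delta> * (if bit (fill_parity s x) q then - 1 else 1) =
      \<beta> * sign_character 5 (\<lambda>k. k = q \<or> q = 5) x" for x
  proof (cases "q = 5")
    case True
    then show ?thesis
      by (simp add: \<beta>_def bit_fill_parity_last sign_character_all del: upt_rec_numeral)
  next
    case False
    with q have "q < 5" by simp
    then have "bit (fill_parity s x) q = bit x q"
      using less_six_cases[OF q] False
      by - (elim disjE; simp only: bit_fill_parity; simp)
    moreover have "sign_character 5 (\<lambda>k. k = q \<or> q = 5) x =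
        (\<Prod>k<5. if k = q then (if bit x q then - 1 else 1) else 1)"
      unfolding sign_character_def using False by (intro prod.cong) auto
    ultimately show ?thesis
      using False \<open>q < 5\<close> by (simp add: \<beta>_def)
  qed
  have "f (fill_parity s x) (fill_parity s y) =
      of_bool (x = y) * (\<alpha> + \<beta> * sign_character 5 (\<lambda>k. k = q \<or> q = 5) x)"
    if xy: "x < 32" "y < 32" for x y
  proof (cases "x = y")
    case True
    then show ?thesis unfolding f diag[symmetric] by (simp add: \<kappa>)
  next
    case False
    with same_parity_agree[OF q xy] show ?thesis unfolding f by auto
  qed
  with q show ?thesis by blast
qed

definition rotated_even_branch :: epp where
  "rotated_even_branch = joint_step 32 1 (\<lambda>_. hadamard) (\<lambda>_ _. hadamard) (\<lambda>_ _. even_branch)"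

lemma purifies_rotated_even_branch:
  "purifies 2 32 (pullback 32 (fill_parity s) (fill_parity s) one_qubit_error) rotated_even_branch"
  unfolding rotated_even_branch_def
proof (rule purifies_joint_step)
  show "purifies 2 32 (\<lambda>g. \<exists>f. pullback 32 (fill_parity s) (fill_parity s) one_qubit_error f \<and>
      g = (\<lambda>x y. \<Sum>y'<32. hadamard $$ (y, y') * (\<Sum>x'<32. hadamard $$ (x, x') * f x' y')))
    even_branch"
    using purifies_even_branch
  proof (rule purifies_mono)
    fix g
    assume "\<exists>f. pullback 32 (fill_parity s) (fill_parity s) one_qubit_error f \<and>
      g = (\<lambda>x y. \<Sum>y'<32. hadamard $$ (y, y') * (\<Sum>x'<32. hadamard $$ (x, x') * f x' y'))"
    then obtain f h where h: "one_qubit_error h"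
      and f: "\<forall>x<32. \<forall>y<32. f x y = h (fill_parity s x) (fill_parity s y)"
      and g: "g = (\<lambda>x y. \<Sum>y'<32. hadamard $$ (y, y') *
          (\<Sum>x'<32. hadamard $$ (x, x') * f x' y'))"
      unfolding pullback_def by blast
    from one_qubit_error_same_parity[OF h, of s] obtain q \<alpha> \<beta> where q: "q < 6"
      and h': "\<forall>x<32. \<forall>y<32. h (fill_parity s x) (fill_parity s y) =
        of_bool (x = y) * (\<alpha> + \<beta> * sign_character 5 (\<lambda>k. k = q \<or> q = 5) x)"
      by blast
    let ?\<chi> = "sign_character 5 (\<lambda>k. k = q \<or> q = 5)"
    have "g x y = \<alpha> * of_bool (flip 6 x y) + \<beta> * of_bool (flip q x y)"
      if xy: "x < 32" "y < 32" for x y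
    proof -
      \<comment> \<open>\<open>f\<close> is diagonal, so Alice's sum has a single nonzero
        term.\<close>
      have inner: "(\<Sum>x'<32. hadamard $$ (x, x') * f x' z) = hadamard $$ (x, z) * (\<alpha> + \<beta> * ?\<chi> z)"
        if "z < 32" for z
      proof -
        have "(\<Sum>x'<32. hadamard $$ (x, x') * f x' z) =
            (\<Sum>x'<32. if x' = z then hadamard $$ (x, z) * (\<alpha> + \<beta> * ?\<chi> z) else 0)"
          using that f h' by (intro sum.cong) auto
        with that show ?thesis by simp
      qed
      have "g x y = (\<Sum>z<32. hadamard $$ (y, z) * (hadamard $$ (x, z) * (\<alpha> + \<beta> * ?\<chi> z)))"
        unfolding g by (intro sum.cong) (auto simp: inner)
      also have "\<dots> =
          \<alpha> * (\<Sum>z<32. hadamard $$ (x, z) * hadamard $$ (y, z) * sign_character 5 (\<lambda>_. False) z) +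
          \<beta> * (\<Sum>z<32. hadamard $$ (x, z) * hadamard $$ (y, z) * ?\<chi> z)"
        unfolding sum_distrib_left sum.distrib[symmetric]
        by (intro sum.cong) (simp_all add: sign_character_def algebra_simps)
      \<comment> \<open>The trivial character yields \<open>flip 6\<close>, since no
        \<open>k < 5\<close> equals 6, and \<open>?\<chi>\<close> has the pattern of
        \<open>flip q\<close>.\<close>
      also have "\<dots> = \<alpha> * of_bool (flip 6 x y) + \<beta> * of_bool (flip q x y)"
        unfolding hadamard_sum[OF xy] flip_def by simp
      finally show ?thesis .
    qed
    then show "pullback 32 (\<lambda>x. x) (\<lambda>x. x) flip_error g"
      using q unfolding pullback_def flip_error_def
      by (intro exI[of _ "\<lambda>x y. \<alpha> * of_bool (flip 6 x y) + \<beta> * of_bool (flip q x y)"]) blast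
  qed
qed (use hadamard_carrier kraus_complete_hadamard in simp_all)

section \<open>The whole protocol\<close>

definition protocol :: epp where
  "protocol = select_step 32 2 64 fill_parity (\<lambda>_. fill_parity)
     (\<lambda>s s'. if s = s' then rotated_even_branch else odd_branch)"

lemma purifies_protocol: "purifies 2 64 (pullback 64 (\<lambda>x. x) (\<lambda>x. x) one_qubit_error) protocol"
  unfolding protocol_def
proof (rule purifies_select_step)
  fix s s' :: nat
  assume "s < 2" "s' < 2"
  then show "purifies 2 32 (pullback 32 (fill_parity s) (fill_parity s') one_qubit_error)
      (if s = s' then rotated_even_branch else odd_branch)"
    using purifies_rotated_even_branch purifies_odd_branch by simp
qed (simp_all add: bases_partition_fill_parity)

text \<open>If no qubit is affected, the operator is a scalar, which counts as an operator on qubit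
  0; \<open>n > 0\<close> provides that qubit.\<close>

lemma act_on_at_most_one:
  assumes "T \<subseteq> {..<n}" "card T \<le> 1" "n > 0"
  shows "\<exists>q<n. \<exists>\<kappa>. \<forall>i<2 ^ n. \<forall>j<2 ^ n. act_on n T K $$ (i, j) =
    (if \<forall>k<n. k \<noteq> q \<longrightarrow> bit i k = bit j k then \<kappa> (bit i q) (bit j q) else 0)"
proof (cases "T = {}")
  case True
  have "act_on n T K $$ (i, j) = (if \<forall>k<n. k \<noteq> 0 \<longrightarrow> bit i k = bit j k
      then if bit i 0 = bit j 0 then K $$ (0, 0) else 0 else 0)" if "i < 2 ^ n" "j < 2 ^ n" for i j
  proof -
    have split_zero: "(\<forall>k\<in>{..<n}. Q k) \<longleftrightarrow> (\<forall>k<n. k \<noteq> 0 \<longrightarrow> Q k) \<and> Q 0" for Q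
      using \<open>n > 0\<close> by (metis lessThan_iff)
    have "act_on n T K $$ (i, j) = (if \<forall>k\<in>{..<n}. bit i k = bit j k then K $$ (0, 0) else 0)"
      using that True by (simp add: act_on_def sub_index_def)
    then show ?thesis unfolding split_zero if_if_eq_conj .
  qed
  with \<open>n > 0\<close> show ?thesis
    by (intro exI[of _ 0] conjI exI[of _ "\<lambda>b c. if b = c then K $$ (0, 0) else 0"]) auto
next
  case False
  have "finite T" using assms(1) finite_subset by blast
  with False assms(2) have "card T = 1" using card_0_eq[of T] by linarith
  then obtain q where T: "T = {q}" by (rule card_1_singletonE)
  with assms(1) have "q < n" by simp
  moreover have "act_on n T K $$ (i, j) = (if \<forall>k<n. k \<noteq> q \<longrightarrow> bit i k = bit j k
      then K $$ (of_bool (bit i q), of_bool (bit j q)) else 0)" if "i < 2 ^ n" "j < 2 ^ n" for i j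
  proof -
    have agree: "(\<forall>k\<in>{..<n} - {q}. bit i k = bit j k) \<longleftrightarrow> (\<forall>k<n. k \<noteq> q \<longrightarrow> bit i k = bit j k)"
      by auto
    have "act_on n T K $$ (i, j) = (if \<forall>k\<in>{..<n} - {q}. bit i k = bit j k
        then K $$ (of_bool (bit i q), of_bool (bit j q)) else 0)"
      using that by (simp add: act_on_def sub_index_def T)
    then show ?thesis unfolding agree .
  qed
  ultimately show ?thesis
    by (intro exI[of _ q] conjI exI[of _ "\<lambda>b c. K $$ (of_bool b, of_bool c)"]) auto
qed

lemma pullback_noisy:
  assumes "T \<subseteq> {..<6}" "card T \<le> 1"
  shows "pullback 64 (\<lambda>x. x) (\<lambda>x. x) one_qubit_error
    (\<lambda>x y. complex_of_real (1 / sqrt 2) ^ 6 * act_on 6 T K $$ (y, x))"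
proof -
  obtain q \<kappa> where q: "q < 6" and act: "\<forall>i<2 ^ 6. \<forall>j<2 ^ 6. act_on 6 T K $$ (i, j) =
      (if \<forall>k<6. k \<noteq> q \<longrightarrow> bit i k = bit j k then \<kappa> (bit i q) (bit j q) else 0)"
    using act_on_at_most_one[OF assms, of K] by auto
  \<comment> \<open>Alice's index comes first in the amplitudes but is the column of the channel
    operator, hence the swapped arguments of \<open>\<kappa>\<close>.\<close>
  define h :: "nat \<Rightarrow> nat \<Rightarrow> complex" where "h = (\<lambda>x y. if \<forall>k<6. k \<noteq> q \<longrightarrow> bit x k = bit y k
    then complex_of_real (1 / sqrt 2) ^ 6 * \<kappa> (bit y q) (bit x q) else 0)"
  have "complex_of_real (1 / sqrt 2) ^ 6 * act_on 6 T K $$ (y, x) = h x y" if "x < 64" "y < 64" for x y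
  proof -
    have sym: "(\<forall>k<6. k \<noteq> q \<longrightarrow> bit y k = bit x k) \<longleftrightarrow> (\<forall>k<6. k \<noteq> q \<longrightarrow> bit x k = bit y k)"
      by auto
    have "act_on 6 T K $$ (y, x) =
        (if \<forall>k<6. k \<noteq> q \<longrightarrow> bit x k = bit y k then \<kappa> (bit y q) (bit x q) else 0)"
      using act that unfolding sym[symmetric] by simp
    then show ?thesis unfolding h_def by (simp only: if_distrib[of "(*) _"] mult_zero_right)
  qed
  moreover have "one_qubit_error h"
    unfolding one_qubit_error_def h_def using q
    by (intro exI[of _ q] conjI exI[of _ "\<lambda>b c. complex_of_real (1 / sqrt 2) ^ 6 * \<kappa> c b"]) auto
  ultimately show ?thesis unfolding pullback_def by blast
qed

lemma mat_trace_smult: "A \<in> carrier_mat d d \<Longrightarrow> mat_trace (c \<cdot>\<^sub>m A) = c * mat_trace A"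
  by (simp add: mat_trace_def sum_distrib_left)

lemma produces_good_pairs_protocol: "produces_good_pairs protocol 2 6 1"
  unfolding produces_good_pairs_def
proof (intro allI impI, clarify)
  fix T Ks m \<sigma>
  assume T: "T \<subseteq> {..<6}" "card T \<le> 1"
    and run: "(m, \<sigma>) \<in> runs (2 ^ 6) (2 ^ 6) protocol (noisy_epr_pairs 6 T Ks)"
    and nz: "mat_trace \<sigma> \<noteq> 0"
  let ?fs = "map (\<lambda>K x y. complex_of_real (1 / sqrt 2) ^ 6 * act_on 6 T K $$ (y, x)) Ks"
  have "\<forall>f\<in>set ?fs. pullback 64 (\<lambda>x. x) (\<lambda>x. x) one_qubit_error f"
    using pullback_noisy[OF T] by auto
  moreover have "(m, \<sigma>) \<in> runs 64 64 protocol (mixture 64 64 ?fs)"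
    using run unfolding noisy_epr_pairs_eq_mixture by simp
  ultimately have "m = 2 \<and> (\<exists>c. \<sigma> = c \<cdot>\<^sub>m projector (epr_pairs 2))"
    using purifies_protocol unfolding purifies_def by blast
  then obtain c where m: "m = 2" and \<sigma>: "\<sigma> = c \<cdot>\<^sub>m projector (epr_pairs 2)" by blast
  \<comment> \<open>The EPR projector has trace 1, so the trace of the run is the factor
    \<open>c\<close>, and normalising gives the projector exactly.\<close>
  have tr: "mat_trace \<sigma> = c"
    unfolding \<sigma> mat_trace_smult[OF projector_carrier] trace_projector_epr_pairs by simp
  with nz have "c \<noteq> 0" by simp
  then have "(1 / c) \<cdot>\<^sub>m \<sigma> = projector (epr_pairs 2)"
    unfolding \<sigma> by (intro eq_matI) auto
  then show "2 \<le> m \<and> (1 / mat_trace \<sigma>) \<cdot>\<^sub>m \<sigma> = projector (epr_pairs m)"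
    by (simp add: m tr)
qed

theorem mainTheorem6:
  shows "(\<exists>P. two_way_epp 6 P \<and> produces_good_pairs P 2 6 1) \<and> \<not> quantum_hamming_bound 6 2 1"
proof
  have "two_way_epp 6 protocol"
    using purifies_protocol by (simp add: two_way_epp_def purifies_def)
  with produces_good_pairs_protocol show "\<exists>P. two_way_epp 6 P \<and> produces_good_pairs P 2 6 1" by blast
  \<comment> \<open>The two sides are 4 * (1 + 18) = 76 and 64.\<close>
  show "\<not> quantum_hamming_bound 6 2 1" by (simp add: quantum_hamming_bound_def)
qed

end
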